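(* Let $G = H_+[0,1]$ be the topological group of orientation-preserving homeomorphisms of $[0,1]$ endowed with the compact open topology. Then $G$ is SUC-trivial, that is, $\mathrm{SUC}(G)$ consists only of the constant functions.
   Context: All topological spaces are Tychonoff. For a topological group $G$ (with neutral element $e$), a $G$-space is a topological space $X$ with a continuous left action $G\times X\to X$; a $G$-map is a continuous $G$-equivariant map. A $G$-compactification of a $G$-space $X$ is a $G$-map $\nu\colon X\to Y$ into a compact (Hausdorff) $G$-space $Y$ with dense image. $G$ itself is a $G$-space under left translations. A compact $G$-space $X$, with its unique compatible uniformity $\mu_X$, is SUC (strongly uniformly continuous) if for every $x_0\in X$ and every entourage $\varepsilon\in\mu_X$ there is a neighborhood $U$ of $e$ in $G$ such that $(gux_0,gx_0)\in\varepsilon$ for all $g\in G$, $u\in U$. For a $G$-space $X$, a bounded continuous function $f\colon X\to\mathbb{R}$ belongs to $\mathrm{SUC}(X)$ if there are a $G$-compactification $\nu\colon X\to Y$ with $Y$ a compact SUC $G$-space and a continuous $F\colon Y\to\mathbb{R}$ with $f=F\circ\nu$. $\mathrm{SUC}(G)$ is the case $X=G$. *)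

theory Defs
  imports "HOL-Analysis.Analysis" "HOL-Algebra.Bij"
begin

definition Tychonoff_space :: "'a topology \<Rightarrow> bool" where
  "Tychonoff_space X \<longleftrightarrow> completely_regular_space X \<and> Hausdorff_space X"

section \<open>Uniformities\<close>

text \<open>The distribution only has uniform spaces as a type class; here is the notion for an
  explicit carrier set, given by the set of all entourages.\<close>

definition uniformity_on :: "'a set \<Rightarrow> ('a \<times> 'a) set set \<Rightarrow> bool" where
  "uniformity_on S \<mu> \<longleftrightarrow>
     S \<times> S \<in> \<mu> \<and>
     (\<forall>E\<in>\<mu>. Id_on S \<subseteq> E \<and> E \<subseteq> S \<times> S) \<and>
     (\<forall>E\<in>\<mu>. \<forall>E'. E \<subseteq> E' \<and> E' \<subseteq> S \<times> S \<longrightarrow> E' \<in> \<mu>) \<and>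
     (\<forall>E\<in>\<mu>. \<forall>E'\<in>\<mu>. E \<inter> E' \<in> \<mu>) \<and>
     (\<forall>E\<in>\<mu>. E\<inverse> \<in> \<mu>) \<and>
     (\<forall>E\<in>\<mu>. \<exists>D\<in>\<mu>. D O D \<subseteq> E)"

definition compatible_uniformity :: "'a topology \<Rightarrow> ('a \<times> 'a) set set \<Rightarrow> bool" where
  "compatible_uniformity X \<mu> \<longleftrightarrow>
     uniformity_on (topspace X) \<mu> \<and>
     (\<forall>W. openin X W \<longleftrightarrow> W \<subseteq> topspace X \<and> (\<forall>x\<in>W. \<exists>E\<in>\<mu>. E `` {x} \<subseteq> W))"

text \<open>Meaningful for compact Hausdorff spaces only, where the compatible uniformity exists and is
  unique (lemma \<open>ex1_compatible_uniformity\<close> below).\<close>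

definition the_uniformity :: "'a topology \<Rightarrow> ('a \<times> 'a) set set" where
  "the_uniformity X = (THE \<mu>. compatible_uniformity X \<mu>)"

section \<open>Topological groups and their actions\<close>

definition topological_group :: "('g, 'm) monoid_scheme \<Rightarrow> 'g topology \<Rightarrow> bool" where
  "topological_group G T \<longleftrightarrow>
     group G \<and> topspace T = carrier G \<and> Tychonoff_space T \<and>
     continuous_map (prod_topology T T) T (\<lambda>(g, h). g \<otimes>\<^bsub>G\<^esub> h) \<and>
     continuous_map T T (\<lambda>g. inv\<^bsub>G\<^esub> g)"

definition G_space ::
  "('g, 'm) monoid_scheme \<Rightarrow> 'g topology \<Rightarrow> 'x topology \<Rightarrow> ('g \<Rightarrow> 'x \<Rightarrow> 'x) \<Rightarrow> bool" where
  "G_space G T X act \<longleftrightarrow>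
     topological_group G T \<and> Tychonoff_space X \<and>
     continuous_map (prod_topology T X) X (\<lambda>(g, x). act g x) \<and>
     (\<forall>x\<in>topspace X. act \<one>\<^bsub>G\<^esub> x = x) \<and>
     (\<forall>g\<in>carrier G. \<forall>h\<in>carrier G. \<forall>x\<in>topspace X. act (g \<otimes>\<^bsub>G\<^esub> h) x = act g (act h x))"

definition G_map ::
  "('g, 'm) monoid_scheme \<Rightarrow> 'g topology \<Rightarrow> 'x topology \<Rightarrow> ('g \<Rightarrow> 'x \<Rightarrow> 'x) \<Rightarrow>
     'y topology \<Rightarrow> ('g \<Rightarrow> 'y \<Rightarrow> 'y) \<Rightarrow> ('x \<Rightarrow> 'y) \<Rightarrow> bool" where
  "G_map G T X actX Y actY \<nu> \<longleftrightarrow>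
     G_space G T X actX \<and> G_space G T Y actY \<and>
     continuous_map X Y \<nu> \<and>
     (\<forall>g\<in>carrier G. \<forall>x\<in>topspace X. \<nu> (actX g x) = actY g (\<nu> x))"

definition G_compactification ::
  "('g, 'm) monoid_scheme \<Rightarrow> 'g topology \<Rightarrow> 'x topology \<Rightarrow> ('g \<Rightarrow> 'x \<Rightarrow> 'x) \<Rightarrow>
     'y topology \<Rightarrow> ('g \<Rightarrow> 'y \<Rightarrow> 'y) \<Rightarrow> ('x \<Rightarrow> 'y) \<Rightarrow> bool" where
  "G_compactification G T X actX Y actY \<nu> \<longleftrightarrow>
     G_map G T X actX Y actY \<nu> \<and>
     compact_space Y \<and> Hausdorff_space Y \<and>
     Y closure_of (\<nu> ` topspace X) = topspace Y"

definition SUC_G_space ::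
  "('g, 'm) monoid_scheme \<Rightarrow> 'g topology \<Rightarrow> 'x topology \<Rightarrow> ('g \<Rightarrow> 'x \<Rightarrow> 'x) \<Rightarrow> bool" where
  "SUC_G_space G T X act \<longleftrightarrow>
     G_space G T X act \<and> compact_space X \<and> Hausdorff_space X \<and>
     (\<forall>x\<^sub>0\<in>topspace X. \<forall>\<epsilon>\<in>the_uniformity X.
        \<exists>U. openin T U \<and> \<one>\<^bsub>G\<^esub> \<in> U \<and>
          (\<forall>g\<in>carrier G. \<forall>u\<in>U. (act (g \<otimes>\<^bsub>G\<^esub> u) x\<^sub>0, act g x\<^sub>0) \<in> \<epsilon>))"

text \<open>A function on a space \<open>X\<close> is represented by any HOL function with the right values on
  \<open>topspace X\<close>. HOL cannot quantify existentially over types inside a formula, so the type \<open>'y\<close>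
  hosting the points of the SUC compactification is a parameter: \<open>SUC(X)\<close> is the union of the sets
  \<open>SUC_functions TYPE('y) G T X act\<close> over all types \<open>'y\<close>.\<close>

definition SUC_functions ::
  "'y itself \<Rightarrow> ('g, 'm) monoid_scheme \<Rightarrow> 'g topology \<Rightarrow>
     'x topology \<Rightarrow> ('g \<Rightarrow> 'x \<Rightarrow> 'x) \<Rightarrow> ('x \<Rightarrow> real) set" where
  "SUC_functions _ G T X actX =
     {f. continuous_map X euclideanreal f \<and> bounded (f ` topspace X) \<and>
       (\<exists>(Y :: 'y topology) actY \<nu> F.
          G_compactification G T X actX Y actY \<nu> \<and> SUC_G_space G T Y actY \<and>
          continuous_map Y euclideanreal F \<and>
          (\<forall>x\<in>topspace X. f x = F (\<nu> x)))}"

section \<open>The group of orientation-preserving homeomorphisms of the unit interval\<close>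

definition compact_open_topology ::
  "'a topology \<Rightarrow> 'b topology \<Rightarrow> ('a \<Rightarrow> 'b) topology" where
  "compact_open_topology X Y =
     topology_generated_by
       {{f \<in> extensional (topspace X). continuous_map X Y f \<and> f ` K \<subseteq> U} |K U.
          compactin X K \<and> openin Y U}"

text \<open>Homeomorphisms are extensional functions, as in \<^const>\<open>BijGroup\<close>, whose multiplication
  is composition. A homeomorphism of an interval preserves orientation iff it is increasing.\<close>

definition Homeo_plus :: "(real \<Rightarrow> real) monoid" where
  "Homeo_plus = BijGroup {0..1}
     \<lparr>carrier := {h \<in> extensional {0..1}.
        homeomorphic_map (top_of_set {0..1}) (top_of_set {0..1}) h \<and> strict_mono_on {0..1} h}\<rparr>"

definition Homeo_plus_topology :: "(real \<Rightarrow> real) topology" where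
  "Homeo_plus_topology =
     subtopology (compact_open_topology (top_of_set {0..1}) (top_of_set {0..1}))
       (carrier Homeo_plus)"

section \<open>The compatible uniformity of a compact Hausdorff space\<close>

definition diag_nbhds :: "'a topology \<Rightarrow> ('a \<times> 'a) set set" where
  "diag_nbhds X = {E. E \<subseteq> topspace X \<times> topspace X \<and>
     (\<exists>W. openin (prod_topology X X) W \<and> Id_on (topspace X) \<subseteq> W \<and> W \<subseteq> E)}"

lemma openin_prod_diag:
  assumes "openin (prod_topology X X) W" "(x, x) \<in> W"
  shows "\<exists>U. openin X U \<and> x \<in> U \<and> U \<times> U \<subseteq> W"
proof -
  obtain A B where AB: "openin X A" "openin X B" "x \<in> A" "x \<in> B" "A \<times> B \<subseteq> W"
    using assms(1)[unfolded openin_prod_topology_alt, rule_format, OF assms(2)] by blast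
  have "openin X (A \<inter> B)" using AB by blast
  moreover have "(A \<inter> B) \<times> (A \<inter> B) \<subseteq> W" using AB(5) by blast
  ultimately show ?thesis using AB(3,4) by blast
qed

lemma compatible_uniformityD:
  assumes "compatible_uniformity X \<mu>"
  shows "topspace X \<times> topspace X \<in> \<mu>"
    and "\<And>E. E \<in> \<mu> \<Longrightarrow> Id_on (topspace X) \<subseteq> E"
    and "\<And>E. E \<in> \<mu> \<Longrightarrow> E \<subseteq> topspace X \<times> topspace X"
    and "\<And>E E'. E \<in> \<mu> \<Longrightarrow> E \<subseteq> E' \<Longrightarrow> E' \<subseteq> topspace X \<times> topspace X \<Longrightarrow> E' \<in> \<mu>"
    and "\<And>E E'. E \<in> \<mu> \<Longrightarrow> E' \<in> \<mu> \<Longrightarrow> E \<inter> E' \<in> \<mu>"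
    and "\<And>E. E \<in> \<mu> \<Longrightarrow> E\<inverse> \<in> \<mu>"
    and "\<And>E. E \<in> \<mu> \<Longrightarrow> \<exists>D\<in>\<mu>. D O D \<subseteq> E"
    and "\<And>W. openin X W \<longleftrightarrow> W \<subseteq> topspace X \<and> (\<forall>x\<in>W. \<exists>E\<in>\<mu>. E `` {x} \<subseteq> W)"
proof -
  note u = assms[unfolded compatible_uniformity_def uniformity_on_def]
  show "topspace X \<times> topspace X \<in> \<mu>"
    by (rule u[THEN conjunct1, THEN conjunct1])
  show "Id_on (topspace X) \<subseteq> E" "E \<subseteq> topspace X \<times> topspace X" if E: "E \<in> \<mu>" for E
    using u[THEN conjunct1, THEN conjunct2, THEN conjunct1, THEN bspec, OF E] by blast+
  show "E' \<in> \<mu>" if E: "E \<in> \<mu>" and E': "E \<subseteq> E'" "E' \<subseteq> topspace X \<times> topspace X" for E E'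
    by (rule u[THEN conjunct1, THEN conjunct2, THEN conjunct2, THEN conjunct1, THEN bspec, OF E, THEN spec, THEN mp, OF conjI[OF E']])
  show "E \<inter> E' \<in> \<mu>" if E: "E \<in> \<mu>" and E': "E' \<in> \<mu>" for E E'
    by (rule u[THEN conjunct1, THEN conjunct2, THEN conjunct2, THEN conjunct2, THEN conjunct1, THEN bspec, OF E, THEN bspec, OF E'])
  show "E\<inverse> \<in> \<mu>" if E: "E \<in> \<mu>" for E
    by (rule u[THEN conjunct1, THEN conjunct2, THEN conjunct2, THEN conjunct2, THEN conjunct2, THEN conjunct1, THEN bspec, OF E])
  show "\<exists>D\<in>\<mu>. D O D \<subseteq> E" if E: "E \<in> \<mu>" for E
    by (rule u[THEN conjunct1, THEN conjunct2, THEN conjunct2, THEN conjunct2, THEN conjunct2, THEN conjunct2, THEN bspec, OF E])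
  show "openin X W \<longleftrightarrow> W \<subseteq> topspace X \<and> (\<forall>x\<in>W. \<exists>E\<in>\<mu>. E `` {x} \<subseteq> W)" for W
    by (rule u[THEN conjunct2, THEN spec])
qed

lemma diag_nbhds_sqrt:
  assumes X: "compact_space X" "Hausdorff_space X" and E: "E \<in> diag_nbhds X"
  shows "\<exists>D\<in>diag_nbhds X. D O D \<subseteq> E"
proof -
  obtain W where W: "openin (prod_topology X X) W" "Id_on (topspace X) \<subseteq> W" "W \<subseteq> E"
    using E unfolding diag_nbhds_def by blast
  have reg: "regular_space X"
    using X by (simp add: compact_Hausdorff_imp_regular_space)
  have "\<exists>U P C. openin X U \<and> openin X P \<and> closedin X C \<and> x \<in> P \<and> P \<subseteq> C \<and> C \<subseteq> U \<and> U \<times> U \<subseteq> W"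
    if x: "x \<in> topspace X" for x
  proof -
    have "(x, x) \<in> W" using W(2) x by auto
    then obtain O' where U: "openin X O'" "x \<in> O'" "O' \<times> O' \<subseteq> W"
      using openin_prod_diag[OF W(1)] by blast
    have nb: "neighbourhood_base_of (closedin X) X"
      using reg by (simp add: neighbourhood_base_of_closedin)
    obtain P C where "openin X P" "closedin X C" "x \<in> P" "P \<subseteq> C" "C \<subseteq> O'"
      using nb[unfolded neighbourhood_base_of, rule_format, OF conjI[OF U(1,2)]] by blast
    then show ?thesis using U by blast
  qed
  then obtain U P C where UPC: "\<And>x. x \<in> topspace X \<Longrightarrow>
      openin X (U x) \<and> openin X (P x) \<and> closedin X (C x) \<and> x \<in> P x \<and> P x \<subseteq> C x \<and> C x \<subseteq> U x
      \<and> U x \<times> U x \<subseteq> W"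
    by metis
  have "\<exists>I. finite I \<and> I \<subseteq> topspace X \<and> topspace X \<subseteq> \<Union>(P ` I)"
  proof -
    have "\<exists>\<F>. finite \<F> \<and> \<F> \<subseteq> P ` topspace X \<and> topspace X \<subseteq> \<Union>\<F>"
      by (rule compactinD[of X "topspace X"]) (use X UPC in \<open>auto simp: compact_space_def\<close>)
    then show ?thesis
      by (metis finite_subset_image)
  qed
  then obtain I where I: "finite I" "I \<subseteq> topspace X" "topspace X \<subseteq> \<Union>(P ` I)" by blast
  define V where "V i = U i \<times> U i \<union> (topspace X - C i) \<times> (topspace X - C i)" for i
  define D where "D = topspace X \<times> topspace X \<inter> (\<Inter>i\<in>I. V i)"
  have "openin (prod_topology X X) (V i)" if "i \<in> I" for i
    unfolding V_def using UPC[of i] I(2) that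
    by (auto intro!: openin_Un simp: openin_prod_Times_iff openin_diff)
  then have oD: "openin (prod_topology X X) D"
    unfolding D_def using openin_topspace[of "prod_topology X X"] I(1)
    by (cases "I = {}") (auto intro!: openin_Int openin_Inter)
  have "(x, x) \<in> V i" if "x \<in> topspace X" "i \<in> I" for x i
  proof -
    have "C i \<subseteq> U i" using UPC[of i] I(2) that(2) by (meson subsetD)
    then show ?thesis using that(1) unfolding V_def by blast
  qed
  then have "Id_on (topspace X) \<subseteq> D" unfolding D_def by auto
  then have "D \<in> diag_nbhds X"
    using oD unfolding diag_nbhds_def D_def by blast
  moreover have "D O D \<subseteq> W"
  proof clarify
    fix x y z assume xy: "(x, y) \<in> D" and yz: "(y, z) \<in> D"
    then have "y \<in> topspace X" by (auto simp: D_def)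
    then obtain i where i: "i \<in> I" "y \<in> P i" using I(3) by blast
    have it: "i \<in> topspace X" using I(2) i(1) by blast
    have "y \<in> C i" using UPC[OF it] i(2) by blast
    then have "x \<in> U i" "z \<in> U i" using xy yz i(1) unfolding D_def V_def by auto
    then show "(x, z) \<in> W" using UPC[OF it] by blast
  qed
  ultimately show ?thesis using W(3) by blast
qed

lemma compatible_diag_nbhds:
  assumes X: "compact_space X" "Hausdorff_space X"
  shows "compatible_uniformity X (diag_nbhds X)"
  unfolding compatible_uniformity_def uniformity_on_def
proof (intro conjI ballI allI impI)
  let ?S = "topspace X"
  have "openin (prod_topology X X) (?S \<times> ?S)" by (simp add: openin_prod_Times_iff)
  then show "?S \<times> ?S \<in> diag_nbhds X" unfolding diag_nbhds_def by blast
next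
  fix E E' assume "E \<in> diag_nbhds X" "E \<subseteq> E' \<and> E' \<subseteq> topspace X \<times> topspace X"
  then show "E' \<in> diag_nbhds X" unfolding diag_nbhds_def by blast
next
  fix E E' assume E: "E \<in> diag_nbhds X" "E' \<in> diag_nbhds X"
  then obtain W W' where "openin (prod_topology X X) W \<and> Id_on (topspace X) \<subseteq> W \<and> W \<subseteq> E"
     "openin (prod_topology X X) W' \<and> Id_on (topspace X) \<subseteq> W' \<and> W' \<subseteq> E'"
    unfolding diag_nbhds_def by blast
  then have "openin (prod_topology X X) (W \<inter> W') \<and> Id_on (topspace X) \<subseteq> W \<inter> W' \<and> W \<inter> W' \<subseteq> E \<inter> E'"
    by blast
  then show "E \<inter> E' \<in> diag_nbhds X" using E unfolding diag_nbhds_def by blast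
next
  fix E assume E: "E \<in> diag_nbhds X"
  then obtain W where W: "openin (prod_topology X X) W" "Id_on (topspace X) \<subseteq> W" "W \<subseteq> E"
    unfolding diag_nbhds_def by blast
  have "openin (prod_topology X X) (W\<inverse>)"
    using W(1) unfolding openin_prod_topology_alt by fast
  then have "openin (prod_topology X X) (W\<inverse>) \<and> Id_on (topspace X) \<subseteq> W\<inverse> \<and> W\<inverse> \<subseteq> E\<inverse>"
    using W by blast
  moreover have "E\<inverse> \<subseteq> topspace X \<times> topspace X" using E unfolding diag_nbhds_def by blast
  ultimately show "E\<inverse> \<in> diag_nbhds X" unfolding diag_nbhds_def by blast
next
  fix E assume "E \<in> diag_nbhds X"
  then show "\<exists>D\<in>diag_nbhds X. D O D \<subseteq> E" using diag_nbhds_sqrt X by blast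
next
  fix W show "openin X W \<longleftrightarrow> W \<subseteq> topspace X \<and> (\<forall>x\<in>W. \<exists>E\<in>diag_nbhds X. E `` {x} \<subseteq> W)"
    (is "?L \<longleftrightarrow> ?R")
  proof
    assume L: ?L
    have "\<exists>E\<in>diag_nbhds X. E `` {x} \<subseteq> W" if x: "x \<in> W" for x
    proof -
      let ?E = "W \<times> W \<union> (topspace X - {x}) \<times> (topspace X - {x})"
      have WX: "W \<subseteq> topspace X" using L by (rule openin_subset)
      have "closedin X {x}" using X(2) x WX by (simp add: closedin_Hausdorff_singleton subset_iff)
      then have "openin (prod_topology X X) ?E"
        using L by (intro openin_Un) (auto simp: openin_prod_Times_iff)
      moreover have "Id_on (topspace X) \<subseteq> ?E" "?E \<subseteq> topspace X \<times> topspace X" using x WX by auto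
      ultimately have "?E \<in> diag_nbhds X" unfolding diag_nbhds_def by blast
      moreover have "?E `` {x} \<subseteq> W" by auto
      ultimately show ?thesis by blast
    qed
    then show ?R using openin_subset[OF L] by blast
  next
    assume R: ?R
    show ?L
    proof (subst openin_subopen, intro ballI)
      fix x assume x: "x \<in> W"
      then obtain E where E: "E \<in> diag_nbhds X" "E `` {x} \<subseteq> W" using R by blast
      then obtain V where V: "openin (prod_topology X X) V" "Id_on (topspace X) \<subseteq> V" "V \<subseteq> E"
        unfolding diag_nbhds_def by blast
      have "(x, x) \<in> V" using V(2) R x by auto
      then obtain A where "openin X A" "x \<in> A" "A \<times> A \<subseteq> V"
        using openin_prod_diag[OF V(1)] by blast
      then show "\<exists>T. openin X T \<and> x \<in> T \<and> T \<subseteq> W" using V(3) E(2) by blast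
    qed
  qed
qed (auto simp: diag_nbhds_def)

lemma compatible_uniformity_nbhd:
  assumes "compatible_uniformity X \<mu>" "E \<in> \<mu>" "x \<in> topspace X"
  shows "\<exists>A. openin X A \<and> x \<in> A \<and> A \<subseteq> E `` {x}"
proof -
  let ?A = "{y \<in> topspace X. \<exists>D\<in>\<mu>. D `` {y} \<subseteq> E `` {x}}"
  note c = compatible_uniformityD[OF assms(1)]
  have "openin X ?A"
  proof -
    have "\<exists>D\<in>\<mu>. D `` {y} \<subseteq> ?A" if y: "y \<in> ?A" for y
    proof -
      obtain D where D: "D \<in> \<mu>" "D `` {y} \<subseteq> E `` {x}" using y by blast
      then obtain D' where D': "D' \<in> \<mu>" "D' O D' \<subseteq> D" using c(7)[OF D(1)] by blast
      have "D' `` {y} \<subseteq> ?A"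
      proof
        fix z assume z: "z \<in> D' `` {y}"
        then have "D' `` {z} \<subseteq> E `` {x}" using D D' by blast
        moreover have "z \<in> topspace X" using z c(3)[OF D'(1)] by blast
        ultimately show "z \<in> ?A" using D' by blast
      qed
      then show ?thesis using D' by blast
    qed
    then show ?thesis unfolding c(8)[of ?A] by blast
  qed
  moreover have "x \<in> ?A" using assms by blast
  moreover have "?A \<subseteq> E `` {x}"
  proof
    fix y assume "y \<in> ?A"
    then obtain D where D: "D \<in> \<mu>" "y \<in> topspace X" "D `` {y} \<subseteq> E `` {x}" by blast
    then have "(y, y) \<in> D" using c(2)[OF D(1)] by blast
    then show "y \<in> E `` {x}" using D by blast
  qed
  ultimately show ?thesis by blast
qed

lemma compatible_uniformity_unique:
  assumes X: "compact_space X" and \<mu>: "compatible_uniformity X \<mu>"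
  shows "\<mu> = diag_nbhds X"
proof -
  note c = compatible_uniformityD[OF \<mu>]
  have sym: "\<exists>D\<in>\<mu>. D\<inverse> = D \<and> D O D \<subseteq> E" if E: "E \<in> \<mu>" for E
  proof -
    obtain D where D: "D \<in> \<mu>" "D O D \<subseteq> E" using c(7)[OF E] by blast
    have "D \<inter> D\<inverse> \<in> \<mu>" using c(5)[OF D(1) c(6)[OF D(1)]] .
    moreover have "(D \<inter> D\<inverse>)\<inverse> = D \<inter> D\<inverse>" by blast
    moreover have "(D \<inter> D\<inverse>) O (D \<inter> D\<inverse>) \<subseteq> E" using D by blast
    ultimately show ?thesis by blast
  qed
  have sub: "E \<subseteq> topspace X \<times> topspace X" if "E \<in> \<mu>" for E using c(3)[OF that] .
  have "\<mu> \<subseteq> diag_nbhds X"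
  proof
    fix E assume E: "E \<in> \<mu>"
    then obtain D where D: "D \<in> \<mu>" "D\<inverse> = D" "D O D \<subseteq> E" using sym by blast
    have "\<exists>A. openin X A \<and> x \<in> A \<and> A \<subseteq> D `` {x}" if "x \<in> topspace X" for x
      using compatible_uniformity_nbhd[OF \<mu> D(1) that] .
    then obtain A where A: "\<And>x. x \<in> topspace X \<Longrightarrow> openin X (A x) \<and> x \<in> A x \<and> A x \<subseteq> D `` {x}"
      by metis
    let ?W = "\<Union>x\<in>topspace X. A x \<times> A x"
    have "openin (prod_topology X X) ?W"
      using A by (intro openin_Union) (auto simp: openin_prod_Times_iff)
    moreover have "Id_on (topspace X) \<subseteq> ?W" using A by auto
    moreover have "?W \<subseteq> E"
    proof clarify
      fix x y z assume "x \<in> topspace X" "y \<in> A x" "z \<in> A x"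
      then have "(x, y) \<in> D" "(x, z) \<in> D" using A by blast+
      then show "(y, z) \<in> E" using D by blast
    qed
    ultimately show "E \<in> diag_nbhds X" using sub[OF E] unfolding diag_nbhds_def by blast
  qed
  moreover have "diag_nbhds X \<subseteq> \<mu>"
  proof
    fix E assume "E \<in> diag_nbhds X"
    then obtain W where W: "openin (prod_topology X X) W" "Id_on (topspace X) \<subseteq> W" "W \<subseteq> E"
      and ES: "E \<subseteq> topspace X \<times> topspace X"
      unfolding diag_nbhds_def by blast
    have "\<exists>D A. D \<in> \<mu> \<and> openin X A \<and> x \<in> A \<and> A \<subseteq> D `` {x} \<and> (D O D) `` {x} \<times> (D O D) `` {x} \<subseteq> W"
      if x: "x \<in> topspace X" for x
    proof -
      have "(x, x) \<in> W" using W(2) x by auto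
      then obtain P where PQ: "openin X P" "x \<in> P" "P \<times> P \<subseteq> W"
        using openin_prod_diag[OF W(1)] by blast
      then obtain F where F: "F \<in> \<mu>" "F `` {x} \<subseteq> P" using c(8)[of P] by blast
      obtain D where D: "D \<in> \<mu>" "D O D \<subseteq> F" using c(7)[OF F(1)] by blast
      then have "(D O D) `` {x} \<times> (D O D) `` {x} \<subseteq> W" using F PQ by blast
      then show ?thesis using compatible_uniformity_nbhd[OF \<mu> D(1) x] D(1) by blast
    qed
    then obtain D A where DA: "\<And>x. x \<in> topspace X \<Longrightarrow> D x \<in> \<mu> \<and> openin X (A x) \<and> x \<in> A x
        \<and> A x \<subseteq> D x `` {x} \<and> (D x O D x) `` {x} \<times> (D x O D x) `` {x} \<subseteq> W"
      by metis
    have "\<exists>\<F>. finite \<F> \<and> \<F> \<subseteq> A ` topspace X \<and> topspace X \<subseteq> \<Union>\<F>"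
      by (rule compactinD[of X "topspace X"]) (use X DA in \<open>auto simp: compact_space_def\<close>)
    then obtain I where I: "finite I" "I \<subseteq> topspace X" "topspace X \<subseteq> \<Union>(A ` I)"
      by (metis finite_subset_image)
    define M where "M J = topspace X \<times> topspace X \<inter> (\<Inter>i\<in>J. D i)" for J
    have "M J \<in> \<mu>" if "finite J" "J \<subseteq> topspace X" for J
      using that
    proof (induction J)
      case empty
      then show ?case using c(1) unfolding M_def by simp
    next
      case (insert i J)
      have "M (insert i J) = D i \<inter> M J" unfolding M_def by auto
      moreover have "D i \<in> \<mu>" "M J \<in> \<mu>" using insert DA by auto
      ultimately show ?case using c(5)[of "D i" "M J"] by simp
    qed
    then have M: "M I \<in> \<mu>" using I by blast
    have "M I \<subseteq> W"
    proof clarify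
      fix y z assume yz: "(y, z) \<in> M I"
      then have "y \<in> topspace X" by (auto simp: M_def)
      then obtain i where i: "i \<in> I" "y \<in> A i" using I(3) by blast
      then have it: "i \<in> topspace X" using I by blast
      have 1: "(i, y) \<in> D i" using DA[OF it] i by blast
      have 2: "(y, z) \<in> D i" "y \<in> topspace X" using yz i by (auto simp: M_def)
      have "Id_on (topspace X) \<subseteq> D i" using DA[OF it] c(2) by blast
      then have "(y, y) \<in> D i" using 2 by blast
      then show "(y, z) \<in> W" using 1 2 DA[OF it] by blast
    qed
    then show "E \<in> \<mu>" using c(4)[OF M _ ES] W(3) by blast
  qed
  ultimately show ?thesis by blast
qed

lemma ex1_compatible_uniformity:
  assumes "compact_space X" "Hausdorff_space X"
  shows "\<exists>!\<mu>. compatible_uniformity X \<mu>"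
proof (rule ex1I)
  show "compatible_uniformity X (diag_nbhds X)" by (rule compatible_diag_nbhds[OF assms])
  show "\<mu> = diag_nbhds X" if "compatible_uniformity X \<mu>" for \<mu>
    using compatible_uniformity_unique[OF assms(1) that] .
qed

section \<open>The homeomorphism group is a topological group\<close>

abbreviation (input) unit_ivl :: "real set" where "unit_ivl \<equiv> {0..1}"

lemma carrier_Homeo_plus:
  "carrier Homeo_plus =
     {h \<in> extensional {0..1}. continuous_on {0..1} h \<and> h ` {0..1} = {0..1} \<and> strict_mono_on {0..1} h}"
proof -
  have "homeomorphic_map (top_of_set unit_ivl) (top_of_set {0..1}) h \<longleftrightarrow>
      continuous_on {0..1} h \<and> h ` {0..1} = {0..1}" if "strict_mono_on {0..1} h" for h :: "real \<Rightarrow> real"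
  proof
    assume "homeomorphic_map (top_of_set unit_ivl) (top_of_set {0..1}) h"
    then show "continuous_on {0..1} h \<and> h ` {0..1} = {0..1}"
      by (auto simp: homeomorphic_eq_everything_map)
  next
    assume "continuous_on {0..1} h \<and> h ` {0..1} = {0..1}"
    moreover have "inj_on h {0..1}" using that by (rule strict_mono_on_imp_inj_on)
    ultimately show "homeomorphic_map (top_of_set unit_ivl) (top_of_set {0..1}) h"
      by (intro continuous_imp_homeomorphic_map)
        (auto simp: compact_space_subtopology Hausdorff_space_subtopology)
  qed
  then show ?thesis by (auto simp: Homeo_plus_def)
qed

lemma Homeo_plusD:
  assumes "h \<in> carrier Homeo_plus"
  shows "h \<in> extensional {0..1}" "continuous_on {0..1} h" "h ` {0..1} = {0..1}"
    "strict_mono_on {0..1} h" "inj_on h {0..1}" "h \<in> Bij {0..1}"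
    "\<And>x. x \<in> {0..1} \<Longrightarrow> h x \<in> {0..1}"
proof -
  show *: "h \<in> extensional {0..1}" "continuous_on {0..1} h" "h ` {0..1} = {0..1}"
    "strict_mono_on {0..1} h"
    using assms by (auto simp: carrier_Homeo_plus)
  then show i: "inj_on h {0..1}" by (simp add: strict_mono_on_imp_inj_on)
  then show "h \<in> Bij {0..1}" using * by (simp add: Bij_def bij_betw_def)
  show "\<And>x. x \<in> {0..1} \<Longrightarrow> h x \<in> {0..1}" using *(3) by blast
qed

lemma subgroup_Homeo_plus: "subgroup (carrier Homeo_plus) (BijGroup {0..1})"
proof (rule group.subgroupI[OF group_BijGroup])
  show "carrier Homeo_plus \<subseteq> carrier (BijGroup {0..1})"
    using Homeo_plusD(6) by (auto simp: BijGroup_def)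
  have "continuous_on unit_ivl (\<lambda>x\<in>{0..1}. x)"
    by (rule continuous_on_eq[OF continuous_on_id]) simp
  then have "(\<lambda>x\<in>{0..1}. x) \<in> carrier Homeo_plus"
    by (simp add: carrier_Homeo_plus strict_mono_on_def del: restrict_apply) simp
  then show "carrier Homeo_plus \<noteq> {}" by blast
next
  fix h assume h: "h \<in> carrier Homeo_plus"
  note D = Homeo_plusD[OF h]
  let ?k = "restrict (inv_into {0..1} h) {0..1}"
  have hk: "?k y \<in> {0..1} \<and> h (?k y) = y" if "y \<in> {0..1}" for y
    using that D(3) by (metis f_inv_into_f inv_into_into restrict_apply')
  have kh: "?k (h x) = x" if "x \<in> {0..1}" for x
    using that D(5,7) by simp
  have "continuous_on (h ` {0..1}) ?k"
    by (rule continuous_on_inv[OF D(2)]) (use kh in auto)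
  then have "continuous_on {0..1} ?k" using D(3) by simp
  moreover have "?k ` {0..1} = {0..1}"
  proof
    show "?k ` {0..1} \<subseteq> {0..1}" using hk by blast
    show "{0..1} \<subseteq> ?k ` {0..1}" using kh D(7) by (metis image_eqI subsetI)
  qed
  moreover have "strict_mono_on {0..1} ?k"
  proof (rule strict_mono_onI, rule ccontr)
    fix r s assume rs: "r \<in> {0..1}" "s \<in> {0..1}" "r < s" "\<not> ?k r < ?k s"
    have "mono_on {0..1} h" using D(4) by (rule strict_mono_on_imp_mono_on)
    then have "h (?k s) \<le> h (?k r)" using hk[OF rs(1)] hk[OF rs(2)] rs(4)
      unfolding mono_on_def by (meson not_less)
    then show False using hk[OF rs(1)] hk[OF rs(2)] rs(3) by linarith
  qed
  ultimately show "inv\<^bsub>BijGroup {0..1}\<^esub> h \<in> carrier Homeo_plus"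
    unfolding inv_BijGroup[OF D(6)] carrier_Homeo_plus by (simp only: mem_Collect_eq restrict_extensional)
next
  fix g h assume g: "g \<in> carrier Homeo_plus" and h: "h \<in> carrier Homeo_plus"
  note G = Homeo_plusD[OF g] and H = Homeo_plusD[OF h]
  have eq: "g \<otimes>\<^bsub>BijGroup {0..1}\<^esub> h = compose {0..1} g h"
    using G(6) H(6) by (simp add: BijGroup_def)
  have "continuous_on {0..1} (g \<circ> h)"
    using G(2) H(2,3) by (intro continuous_on_compose) auto
  then have "continuous_on {0..1} (compose {0..1} g h)"
    by (rule continuous_on_eq) (simp add: compose_def)
  moreover have "compose {0..1} g h ` {0..1} = g ` h ` {0..1}"
    by (force simp: compose_def)
  then have "compose {0..1} g h ` {0..1} = {0..1}" using G(3) H(3) by simp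
  moreover have "strict_mono_on {0..1} (compose {0..1} g h)"
  proof (rule strict_mono_onI)
    fix r s :: real assume rs: "r \<in> {0..1}" "s \<in> {0..1}" "r < s"
    then have "h r < h s" using H(4) by (simp add: strict_mono_on_def)
    then have "g (h r) < g (h s)" using G(4) H(7)[OF rs(1)] H(7)[OF rs(2)] by (simp add: strict_mono_on_def)
    then show "compose {0..1} g h r < compose {0..1} g h s" using rs by (simp add: compose_def)
  qed
  ultimately show "g \<otimes>\<^bsub>BijGroup {0..1}\<^esub> h \<in> carrier Homeo_plus"
    unfolding eq carrier_Homeo_plus by simp
qed

lemma Homeo_plus_eq: "Homeo_plus = BijGroup {0..1}\<lparr>carrier := carrier Homeo_plus\<rparr>"
  by (simp add: Homeo_plus_def)

lemma group_Homeo_plus: "group Homeo_plus"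
  by (subst Homeo_plus_eq) (rule subgroup.subgroup_is_group[OF subgroup_Homeo_plus group_BijGroup])

lemma mult_Homeo_plus:
  assumes "g \<in> carrier Homeo_plus" "h \<in> carrier Homeo_plus"
  shows "g \<otimes>\<^bsub>Homeo_plus\<^esub> h = compose {0..1} g h"
  using Homeo_plusD(6)[OF assms(1)] Homeo_plusD(6)[OF assms(2)]
  by (simp add: Homeo_plus_def BijGroup_def)

lemma one_Homeo_plus: "\<one>\<^bsub>Homeo_plus\<^esub> = (\<lambda>x\<in>{0..1}. x)"
  by (simp add: Homeo_plus_def BijGroup_def)

lemma inv_Homeo_plus:
  assumes h: "h \<in> carrier Homeo_plus" and x: "x \<in> {0..1}"
  shows "h ((inv\<^bsub>Homeo_plus\<^esub> h) x) = x" "(inv\<^bsub>Homeo_plus\<^esub> h) (h x) = x"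
proof -
  interpret group Homeo_plus by (rule group_Homeo_plus)
  have i: "inv\<^bsub>Homeo_plus\<^esub> h \<in> carrier Homeo_plus" using h by (rule inv_closed)
  show "h ((inv\<^bsub>Homeo_plus\<^esub> h) x) = x"
    using fun_cong[OF r_inv[OF h], of x] mult_Homeo_plus[OF h i] x
    by (simp add: one_Homeo_plus compose_def)
  show "(inv\<^bsub>Homeo_plus\<^esub> h) (h x) = x"
    using fun_cong[OF l_inv[OF h], of x] mult_Homeo_plus[OF i h] x
    by (simp add: one_Homeo_plus compose_def)
qed

text \<open>The compact-open topology on the group is induced by the supremum metric.\<close>

definition Homeo_plus_dist :: "(real \<Rightarrow> real) \<Rightarrow> (real \<Rightarrow> real) \<Rightarrow> real" where
  "Homeo_plus_dist f g =
     (if f \<in> carrier Homeo_plus \<and> g \<in> carrier Homeo_plus then SUP x\<in>{0..1}. \<bar>f x - g x\<bar> else 0)"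

lemma Homeo_plus_dist_le:
  assumes "f \<in> carrier Homeo_plus" "g \<in> carrier Homeo_plus"
  shows "Homeo_plus_dist f g \<le> a \<longleftrightarrow> (\<forall>x\<in>{0..1}. \<bar>f x - g x\<bar> \<le> a)"
proof -
  have "\<bar>f x - g x\<bar> \<le> 1" if "x \<in> {0..1}" for x
    using Homeo_plusD(7)[OF assms(1) that] Homeo_plusD(7)[OF assms(2) that] by auto
  then have "bdd_above ((\<lambda>x. \<bar>f x - g x\<bar>) ` {0..1})" by (intro bdd_aboveI2) auto
  then show ?thesis using assms by (simp add: Homeo_plus_dist_def cSUP_le_iff)
qed

lemma Homeo_plus_dist_ge:
  assumes "f \<in> carrier Homeo_plus" "g \<in> carrier Homeo_plus" "x \<in> {0..1}"
  shows "\<bar>f x - g x\<bar> \<le> Homeo_plus_dist f g"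
  using Homeo_plus_dist_le[OF assms(1,2), of "Homeo_plus_dist f g"] assms(3) by simp

lemma Metric_space_Homeo_plus: "Metric_space (carrier Homeo_plus) Homeo_plus_dist"
proof
  fix f g :: "real \<Rightarrow> real"
  show "0 \<le> Homeo_plus_dist f g"
  proof (cases "f \<in> carrier Homeo_plus \<and> g \<in> carrier Homeo_plus")
    case True
    then have "\<bar>f 0 - g 0\<bar> \<le> Homeo_plus_dist f g" by (intro Homeo_plus_dist_ge) auto
    then show ?thesis by linarith
  qed (auto simp: Homeo_plus_dist_def)
  show "Homeo_plus_dist f g = Homeo_plus_dist g f"
    unfolding Homeo_plus_dist_def by (simp add: abs_minus_commute conj_commute)
next
  fix f g :: "real \<Rightarrow> real" assume fg: "f \<in> carrier Homeo_plus" "g \<in> carrier Homeo_plus"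
  have "f = g" if "Homeo_plus_dist f g = 0"
  proof (rule extensionalityI[OF Homeo_plusD(1)[OF fg(1)] Homeo_plusD(1)[OF fg(2)]])
    fix x :: real assume "x \<in> {0..1}"
    then show "f x = g x" using Homeo_plus_dist_ge[OF fg, of x] that by auto
  qed
  moreover have "Homeo_plus_dist f f = 0" using fg by (simp add: Homeo_plus_dist_def)
  ultimately show "Homeo_plus_dist f g = 0 \<longleftrightarrow> f = g" by auto
next
  fix f g h :: "real \<Rightarrow> real"
  assume A: "f \<in> carrier Homeo_plus" "g \<in> carrier Homeo_plus" "h \<in> carrier Homeo_plus"
  show "Homeo_plus_dist f h \<le> Homeo_plus_dist f g + Homeo_plus_dist g h"
    unfolding Homeo_plus_dist_le[OF A(1,3)]
  proof
    fix x :: real assume x: "x \<in> {0..1}"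
    show "\<bar>f x - h x\<bar> \<le> Homeo_plus_dist f g + Homeo_plus_dist g h"
      using Homeo_plus_dist_ge[OF A(1,2) x] Homeo_plus_dist_ge[OF A(2,3) x] by linarith
  qed
qed

interpretation Homeo_plus: Metric_space "carrier Homeo_plus" Homeo_plus_dist
  by (rule Metric_space_Homeo_plus)

lemma Homeo_plus_unif:
  assumes h: "h \<in> carrier Homeo_plus" and e: "e > 0"
  shows "\<exists>d>0. \<forall>x\<in>{0..1}. \<forall>y\<in>{0..1}. \<bar>x - y\<bar> < d \<longrightarrow> \<bar>h x - h y\<bar> < e"
proof -
  have "uniformly_continuous_on {0..1} h"
    using Homeo_plusD(2)[OF h] by (intro compact_uniformly_continuous) auto
  then obtain d where "d > 0" "\<And>x y. x \<in> {0..1} \<Longrightarrow> y \<in> {0..1} \<Longrightarrow> dist y x < d \<Longrightarrow> dist (h y) (h x) < e"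
    using e unfolding uniformly_continuous_on_def by metis
  then show ?thesis unfolding dist_real_def by blast
qed

lemma Homeo_plus_topology_eq: "Homeo_plus_topology = Homeo_plus.mtopology"
proof (rule topology_eq[THEN iffD2], intro allI iffI)
  let ?B = "{{f \<in> extensional (topspace (top_of_set unit_ivl)).
      continuous_map (top_of_set {0..1}) (top_of_set unit_ivl) f \<and> f ` K \<subseteq> U} |K U.
          compactin (top_of_set {0..1}) K \<and> openin (top_of_set unit_ivl) U}"
  have B: "{f \<in> extensional {0..1}. continuous_on {0..1} f \<and> f ` {0..1} \<subseteq> {0..1} \<and> f ` K \<subseteq> U} \<in> ?B"
    if "compact K" "K \<subseteq> {0..1}" "openin (top_of_set unit_ivl) U" for K U
    using that by (intro CollectI exI[of _ K] exI[of _ U])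
      (auto simp: compactin_subtopology image_subset_iff_funcset)
  have top: "Homeo_plus_topology = subtopology (topology_generated_by ?B) (carrier Homeo_plus)"
    unfolding Homeo_plus_topology_def compact_open_topology_def ..
  {
    fix S assume S: "openin Homeo_plus_topology S"
    have "continuous_map Homeo_plus.mtopology (topology_generated_by ?B) (\<lambda>f. f)"
    proof (rule continuous_on_generated_topo)
      fix V assume "V \<in> ?B"
      then obtain K U where KU: "compact K" "K \<subseteq> {0..1}" "openin (top_of_set unit_ivl) U"
        "V = {f \<in> extensional {0..1}. continuous_map (top_of_set {0..1}) (top_of_set unit_ivl) f \<and> f ` K \<subseteq> U}"
        by (auto simp: compactin_subtopology)
      obtain U' where U': "open U'" "U = {0..1} \<inter> U'" using KU(3) by (auto simp: openin_open)
      have V: "f \<in> V \<longleftrightarrow> f ` K \<subseteq> U'" if "f \<in> carrier Homeo_plus" for f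
        using Homeo_plusD[OF that] KU(2) unfolding KU(4) U'(2) by auto
      show "openin Homeo_plus.mtopology ((\<lambda>f. f) -` V \<inter> topspace Homeo_plus.mtopology)"
        unfolding Homeo_plus.openin_mtopology
      proof (intro conjI allI impI)
        show "(\<lambda>f. f) -` V \<inter> topspace Homeo_plus.mtopology \<subseteq> carrier Homeo_plus" by simp
        fix h assume "h \<in> (\<lambda>f. f) -` V \<inter> topspace Homeo_plus.mtopology"
        then have h: "h \<in> carrier Homeo_plus" "h ` K \<subseteq> U'" using V by auto
        have "compact (h ` K)"
          using Homeo_plusD(2)[OF h(1)] KU(1,2) by (meson compact_continuous_image continuous_on_subset)
        then obtain e where e: "e > 0" "(\<Union>x\<in>h ` K. ball x e) \<subseteq> U'"
          using compact_subset_open_imp_ball_epsilon_subset[OF _ U'(1) h(2)] by blast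
        have "g \<in> V" if g: "g \<in> carrier Homeo_plus" "Homeo_plus_dist h g < e" for g
        proof -
          have "g x \<in> U'" if "x \<in> K" for x
          proof -
            have "\<bar>h x - g x\<bar> < e"
              using Homeo_plus_dist_ge[OF h(1) g(1), of x] that KU(2) g(2) by force
            then have "g x \<in> ball (h x) e" by (simp add: dist_real_def)
            then show ?thesis using e(2) that by blast
          qed
          then show ?thesis using V[OF g(1)] by blast
        qed
        then have "Homeo_plus.mball h e \<subseteq> (\<lambda>f. f) -` V \<inter> topspace Homeo_plus.mtopology" by auto
        then show "\<exists>r>0. Homeo_plus.mball h r \<subseteq> (\<lambda>f. f) -` V \<inter> topspace Homeo_plus.mtopology"
          using e(1) by blast
      qed
    next
      have "carrier Homeo_plus \<subseteq>
          {f \<in> extensional {0..1}. continuous_on {0..1} f \<and> f ` {0..1} \<subseteq> {0..1} \<and> f ` {} \<subseteq> {}}"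
        using Homeo_plusD by blast
      then show "(\<lambda>f. f) ` topspace Homeo_plus.mtopology \<subseteq> \<Union> ?B"
        using B[of "{}" "{}"] by auto
    qed
    then have "continuous_map Homeo_plus.mtopology Homeo_plus_topology (\<lambda>f. f)"
      unfolding top by (intro continuous_map_into_subtopology) auto
    then have "openin Homeo_plus.mtopology {x \<in> topspace Homeo_plus.mtopology. x \<in> S}"
      using S by (rule openin_continuous_map_preimage)
    moreover have "S \<subseteq> topspace Homeo_plus.mtopology"
      using openin_subset[OF S] unfolding top by auto
    moreover from this have "{x \<in> topspace Homeo_plus.mtopology. x \<in> S} = S" by blast
    ultimately show "openin Homeo_plus.mtopology S" by simp
  next
    fix S assume S: "openin Homeo_plus.mtopology S"
    show "openin Homeo_plus_topology S"
    proof (subst openin_subopen, intro ballI)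
      fix h assume hS: "h \<in> S"
      then obtain r where r: "r > 0" "Homeo_plus.mball h r \<subseteq> S"
        using S unfolding Homeo_plus.openin_mtopology by blast
      have h: "h \<in> carrier Homeo_plus" using hS S unfolding Homeo_plus.openin_mtopology by blast
      obtain d where d: "d > 0" "\<And>x y. x \<in> {0..1} \<Longrightarrow> y \<in> {0..1} \<Longrightarrow> \<bar>x - y\<bar> < d \<Longrightarrow> \<bar>h x - h y\<bar> < r / 3"
        using Homeo_plus_unif[OF h, of "r / 3"] r(1) by auto
      have "\<exists>F. finite F \<and> F \<subseteq> {0..1} \<and> unit_ivl \<subseteq> (\<Union>x\<in>F. ball x (d / 2))"
      proof -
        have "\<And>x. x \<in> unit_ivl \<Longrightarrow> open (ball x (d / 2))" "unit_ivl \<subseteq> (\<Union>x\<in>unit_ivl. ball x (d / 2))"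
          using d(1) by auto
        then show ?thesis by (meson compactE_image compact_Icc)
      qed
      then obtain F where F: "finite F" "F \<subseteq> {0..1}" "unit_ivl \<subseteq> (\<Union>x\<in>F. ball x (d / 2))" by blast
      define K where "K p = {0..1} \<inter> cball p (d / 2)" for p :: real
      define U where "U p = {0..1} \<inter> ball (h p) (r / 3)" for p
      define W where "W p = {f \<in> extensional unit_ivl. continuous_on {0..1} f \<and> f ` {0..1} \<subseteq> {0..1} \<and> f ` K p \<subseteq> U p}" for p
      have W: "openin (topology_generated_by ?B) (W p)" for p
        unfolding W_def
        by (rule topology_generated_by_Basis, rule B) (auto simp: K_def U_def openin_open)
      have hW: "h \<in> W p" if "p \<in> F" for p
      proof -
        have "h x \<in> U p" if "x \<in> K p" for x
          using d(2)[of p x] F(2) \<open>p \<in> F\<close> that d(1) Homeo_plusD(7)[OF h]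
          by (auto simp: K_def U_def dist_real_def)
        then show ?thesis using Homeo_plusD[OF h] unfolding W_def by auto
      qed
      have "F \<noteq> {}" using F(3) by auto
      then have "openin (topology_generated_by ?B) (\<Inter>p\<in>F. W p)"
        using W F(1) by (intro openin_Inter) auto
      then have "openin Homeo_plus_topology ((\<Inter>p\<in>F. W p) \<inter> carrier Homeo_plus)"
        unfolding top by (rule openin_subtopology_Int)
      moreover have "h \<in> (\<Inter>p\<in>F. W p) \<inter> carrier Homeo_plus" using hW h by blast
      moreover have "(\<Inter>p\<in>F. W p) \<inter> carrier Homeo_plus \<subseteq> S"
      proof
        fix g assume g: "g \<in> (\<Inter>p\<in>F. W p) \<inter> carrier Homeo_plus"
        have "\<bar>h x - g x\<bar> \<le> 2 * r / 3" if x: "x \<in> {0..1}" for x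
        proof -
          obtain p where p: "p \<in> F" "x \<in> ball p (d / 2)" using F(3) x by blast
          then have "x \<in> K p" using x by (auto simp: K_def)
          moreover have "g \<in> W p" "h \<in> W p" using g hW[OF p(1)] p(1) by auto
          then have "g ` K p \<subseteq> U p" "h ` K p \<subseteq> U p" by (simp_all add: W_def)
          ultimately have "g x \<in> U p" "h x \<in> U p" by auto
          then have "\<bar>h p - g x\<bar> < r / 3" "\<bar>h p - h x\<bar> < r / 3" by (simp_all add: U_def dist_real_def)
          then show ?thesis by linarith
        qed
        then have "Homeo_plus_dist h g \<le> 2 * r / 3" using Homeo_plus_dist_le[OF h] g by blast
        then have "g \<in> Homeo_plus.mball h r" using h g r(1) by simp
        then show "g \<in> S" using r(2) by blast
      qed
      ultimately show "\<exists>T. openin Homeo_plus_topology T \<and> h \<in> T \<and> T \<subseteq> S" by blast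
    qed
  }
qed

lemma topological_group_Homeo_plus: "topological_group Homeo_plus Homeo_plus_topology"
  unfolding topological_group_def Homeo_plus_topology_eq
proof (intro conjI)
  interpret group Homeo_plus by (rule group_Homeo_plus)
  show "group Homeo_plus" by (rule group_Homeo_plus)
  show "topspace Homeo_plus.mtopology = carrier Homeo_plus" by simp
  show "Tychonoff_space Homeo_plus.mtopology"
    unfolding Tychonoff_space_def
    using Homeo_plus.metrizable_space_mtopology metrizable_imp_completely_regular_space
      metrizable_imp_Hausdorff_space by blast
  show "continuous_map (prod_topology Homeo_plus.mtopology Homeo_plus.mtopology)
      Homeo_plus.mtopology (\<lambda>(g, h). g \<otimes>\<^bsub>Homeo_plus\<^esub> h)"
    unfolding Homeo_plus.continuous_map_to_metric
  proof (intro ballI allI impI)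
    fix p and e :: real assume p: "p \<in> topspace (prod_topology Homeo_plus.mtopology Homeo_plus.mtopology)"
      and e: "e > 0"
    obtain g h where gh: "p = (g, h)" "g \<in> carrier Homeo_plus" "h \<in> carrier Homeo_plus"
      using p by auto
    obtain d where d: "d > 0" "\<And>x y. x \<in> {0..1} \<Longrightarrow> y \<in> {0..1} \<Longrightarrow> \<bar>x - y\<bar> < d \<Longrightarrow> \<bar>g x - g y\<bar> < e / 3"
      using Homeo_plus_unif[OF gh(2), of "e / 3"] e by auto
    let ?U = "Homeo_plus.mball g (e / 3) \<times> Homeo_plus.mball h d"
    have "openin (prod_topology Homeo_plus.mtopology Homeo_plus.mtopology) ?U"
      by (simp add: openin_prod_Times_iff)
    moreover have "p \<in> ?U" using gh d(1) e by simp
    moreover have "(case q of (g, h) \<Rightarrow> g \<otimes>\<^bsub>Homeo_plus\<^esub> h)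
        \<in> Homeo_plus.mball (case p of (g, h) \<Rightarrow> g \<otimes>\<^bsub>Homeo_plus\<^esub> h) e" if q: "q \<in> ?U" for q
    proof -
      obtain g' h' where gh': "q = (g', h')" "g' \<in> carrier Homeo_plus" "h' \<in> carrier Homeo_plus"
        "Homeo_plus_dist g g' < e / 3" "Homeo_plus_dist h h' < d" using q by auto
      have "\<bar>(g \<otimes>\<^bsub>Homeo_plus\<^esub> h) x - (g' \<otimes>\<^bsub>Homeo_plus\<^esub> h') x\<bar> \<le> 2 * e / 3" if x: "x \<in> {0..1}" for x
      proof -
        have I: "h x \<in> {0..1}" "h' x \<in> {0..1}" using Homeo_plusD(7) gh(3) gh'(3) x by blast+
        have "\<bar>h x - h' x\<bar> < d" using Homeo_plus_dist_ge[OF gh(3) gh'(3) x] gh'(5) by linarith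
        then have "\<bar>g (h x) - g (h' x)\<bar> < e / 3" using d(2)[OF I] by blast
        moreover have "\<bar>g (h' x) - g' (h' x)\<bar> < e / 3"
          using Homeo_plus_dist_ge[OF gh(2) gh'(2) I(2)] gh'(4) by linarith
        ultimately have "\<bar>g (h x) - g' (h' x)\<bar> \<le> 2 * e / 3" by linarith
        then show ?thesis
          using x mult_Homeo_plus[OF gh(2,3)] mult_Homeo_plus[OF gh'(2,3)] by (simp add: compose_def)
      qed
      then have "Homeo_plus_dist (g \<otimes>\<^bsub>Homeo_plus\<^esub> h) (g' \<otimes>\<^bsub>Homeo_plus\<^esub> h') \<le> 2 * e / 3"
        using Homeo_plus_dist_le[OF m_closed[OF gh(2,3)] m_closed[OF gh'(2,3)]] by blast
      then show ?thesis using gh gh' e by simp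
    qed
    ultimately show "\<exists>U. openin (prod_topology Homeo_plus.mtopology Homeo_plus.mtopology) U \<and> p \<in> U \<and>
        (\<forall>q\<in>U. (case q of (g, h) \<Rightarrow> g \<otimes>\<^bsub>Homeo_plus\<^esub> h)
          \<in> Homeo_plus.mball (case p of (g, h) \<Rightarrow> g \<otimes>\<^bsub>Homeo_plus\<^esub> h) e)" by blast
  qed
  show "continuous_map Homeo_plus.mtopology Homeo_plus.mtopology (\<lambda>g. inv\<^bsub>Homeo_plus\<^esub> g)"
    unfolding Homeo_plus.continuous_map_to_metric
  proof (intro ballI allI impI)
    fix h and e :: real assume h0: "h \<in> topspace Homeo_plus.mtopology" and e: "e > 0"
    have h: "h \<in> carrier Homeo_plus" using h0 by simp
    let ?k = "inv\<^bsub>Homeo_plus\<^esub> h"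
    have k: "?k \<in> carrier Homeo_plus" using h by simp
    obtain d where d: "d > 0" "\<And>x y. x \<in> {0..1} \<Longrightarrow> y \<in> {0..1} \<Longrightarrow> \<bar>x - y\<bar> < d \<Longrightarrow> \<bar>?k x - ?k y\<bar> < e / 2"
      using Homeo_plus_unif[OF k, of "e / 2"] e by auto
    have "inv\<^bsub>Homeo_plus\<^esub> g \<in> Homeo_plus.mball ?k e" if "g \<in> Homeo_plus.mball h d" for g
    proof -
      have g: "g \<in> carrier Homeo_plus" "Homeo_plus_dist h g < d" using that by auto
      have i: "inv\<^bsub>Homeo_plus\<^esub> g \<in> carrier Homeo_plus" using g by simp
      have "\<bar>?k y - (inv\<^bsub>Homeo_plus\<^esub> g) y\<bar> \<le> e / 2" if y: "y \<in> {0..1}" for y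
      proof -
        define x where "x = (inv\<^bsub>Homeo_plus\<^esub> g) y"
        have x: "x \<in> {0..1}" using Homeo_plusD(7)[OF i y] by (simp add: x_def)
        have "g x = y" using inv_Homeo_plus(1)[OF g(1) y] by (simp add: x_def)
        moreover have "\<bar>h x - g x\<bar> < d" using Homeo_plus_dist_ge[OF h g(1) x] g(2) by linarith
        ultimately have "\<bar>y - h x\<bar> < d" by linarith
        then have "\<bar>?k y - ?k (h x)\<bar> < e / 2" using d(2)[OF y Homeo_plusD(7)[OF h x]] by blast
        then show ?thesis using inv_Homeo_plus(2)[OF h x] by (simp add: x_def)
      qed
      then have "Homeo_plus_dist ?k (inv\<^bsub>Homeo_plus\<^esub> g) \<le> e / 2"
        using Homeo_plus_dist_le[OF k i] by blast
      then show ?thesis using k i e by simp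
    qed
    moreover have "openin Homeo_plus.mtopology (Homeo_plus.mball h d)" "h \<in> Homeo_plus.mball h d"
      using h d(1) by auto
    ultimately show "\<exists>U. openin Homeo_plus.mtopology U \<and> h \<in> U \<and>
        (\<forall>g\<in>U. inv\<^bsub>Homeo_plus\<^esub> g \<in> Homeo_plus.mball ?k e)" by blast
  qed
qed

lemma G_space_Homeo_plus_left:
  "G_space Homeo_plus Homeo_plus_topology Homeo_plus_topology (\<lambda>g x. g \<otimes>\<^bsub>Homeo_plus\<^esub> x)"
proof -
  interpret group Homeo_plus by (rule group_Homeo_plus)
  show ?thesis
    using topological_group_Homeo_plus
    by (auto simp: G_space_def topological_group_def m_assoc)
qed

end

theory Submission
  imports Defs
begin

text \<open>On every compact SUC space \<open>Y\<close> the group acts trivially, so functions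
  factoring through an equivariant map into \<open>Y\<close> are constant. In the orbit closure of any
  point under the homeomorphisms supported in \<open>[a, b]\<close>, contractions towards \<open>a\<close> produce a point
  fixed by all of them. A point fixed by the homeomorphisms supported in \<open>[a, c]\<close> and by those
  supported in \<open>[c, b]\<close> is fixed by those supported in \<open>[a, b]\<close>, because elements fixing it stretch
  arbitrarily small displacements of \<open>c\<close> to arbitrary ones. Moving through the intervals
  \<open>[i/N, (i+1)/N]\<close> one after the other yields a global fixed point in the orbit closure of \<open>y\<close> under
  the stabilizer of all the points \<open>j/N\<close>; that stabilizer is close to the identity, so the fixed
  point is close to \<open>y\<close>, and \<open>y\<close> is itself fixed.\<close>

section \<open>Compact SUC spaces\<close>

text \<open>Otherwise every point has a neighbourhood that the sequence eventually avoids, and a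
  late term would avoid a whole finite subcover. Cluster points stand in for limits because
  compactness alone does not provide convergent subsequences.\<close>

lemma compact_space_cluster_point:
  fixes s :: "nat \<Rightarrow> 'a"
  assumes X: "compact_space X" and s: "\<And>n. s n \<in> topspace X"
  obtains x where "x \<in> topspace X"
    and "\<And>W n. openin X W \<Longrightarrow> x \<in> W \<Longrightarrow> \<exists>m\<ge>n. s m \<in> W"
proof -
  have "\<exists>x\<in>topspace X. \<forall>W n. openin X W \<longrightarrow> x \<in> W \<longrightarrow> (\<exists>m\<ge>n. s m \<in> W)"
  proof (rule ccontr)
    assume "\<not> ?thesis"
    then obtain W n where Wn: "\<And>x. x \<in> topspace X \<Longrightarrow> openin X (W x) \<and> x \<in> W x \<and> (\<forall>m\<ge>n x. s m \<notin> W x)"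
      by metis
    have "\<exists>\<F>. finite \<F> \<and> \<F> \<subseteq> W ` topspace X \<and> topspace X \<subseteq> \<Union>\<F>"
      by (rule compactinD[of X "topspace X"]) (use X Wn in \<open>auto simp: compact_space_def\<close>)
    then obtain I where I: "finite I" "I \<subseteq> topspace X" "topspace X \<subseteq> \<Union>(W ` I)"
      by (metis finite_subset_image)
    obtain i where i: "i \<in> I" "s (Max (n ` I)) \<in> W i" using I(3) s by blast
    then have "n i \<le> Max (n ` I)" using I(1) by simp
    then show False using Wn[of i] i I(2) by blast
  qed
  then show ?thesis using that by blast
qed

lemma the_uniformity_eq:
  assumes "compact_space X" "Hausdorff_space X"
  shows "the_uniformity X = diag_nbhds X"
  unfolding the_uniformity_def
  using compatible_diag_nbhds[OF assms] compatible_uniformity_unique[OF assms(1)]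
  by (rule the_equality)

section \<open>Continuity of the action and closedness of fixed point sets\<close>

lemma G_space_act_closed:
  assumes "G_space G T X act" "g \<in> carrier G" "x \<in> topspace X"
  shows "act g x \<in> topspace X"
proof -
  have "(g, x) \<in> topspace (prod_topology T X)"
    using assms by (simp add: G_space_def topological_group_def)
  moreover have "continuous_map (prod_topology T X) X (\<lambda>(g, x). act g x)"
    using assms(1) by (simp add: G_space_def)
  ultimately show ?thesis
    using continuous_map_image_subset_topspace by fastforce
qed

lemma G_space_act_continuous:
  assumes "G_space G T X act"
  shows "g \<in> carrier G \<Longrightarrow> continuous_map X X (act g)"
    and "x \<in> topspace X \<Longrightarrow> continuous_map T X (\<lambda>g. act g x)"
proof -
  have c: "continuous_map (prod_topology T X) X (\<lambda>(g, x). act g x)"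
    and T: "topspace T = carrier G"
    using assms by (simp_all add: G_space_def topological_group_def)
  show "continuous_map X X (act g)" if "g \<in> carrier G"
  proof -
    have "continuous_map X (prod_topology T X) (\<lambda>x. (g, x))"
      using that T by (intro continuous_map_pairedI) auto
    from continuous_map_compose[OF this c] show ?thesis by (simp add: o_def)
  qed
  show "continuous_map T X (\<lambda>g. act g x)" if "x \<in> topspace X"
  proof -
    have "continuous_map T (prod_topology T X) (\<lambda>g. (g, x))"
      using that by (intro continuous_map_pairedI) auto
    from continuous_map_compose[OF this c] show ?thesis by (simp add: o_def)
  qed
qed

lemma closedin_fixed_points:
  assumes "G_space G T X act" "Hausdorff_space X" "g \<in> carrier G"
  shows "closedin X {x \<in> topspace X. act g x = x}"
  using closedin_continuous_maps_eq[OF assms(2) G_space_act_continuous(1)[OF assms(1,3)] continuous_map_id]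
  by simp

lemma closedin_stabilizer:
  assumes "G_space G T X act" "Hausdorff_space X" "x \<in> topspace X"
  shows "closedin T {g \<in> topspace T. act g x = x}"
  using closedin_continuous_maps_eq[OF assms(2) G_space_act_continuous(2)[OF assms(1,3)], of "\<lambda>_. x"] assms(3)
  by simp

text \<open>Regularity shrinks two disjoint open sets to ones with disjoint closures. The closures
  matter: their product misses the diagonal, so its complement is an entourage, and limits from the
  two sides stay distinct.\<close>

lemma regular_separation:
  assumes X: "regular_space X" "Hausdorff_space X" and pq: "p \<in> topspace X" "q \<in> topspace X" "p \<noteq> q"
  obtains A B where "openin X A" "openin X B" "p \<in> A" "q \<in> B"
    "X closure_of A \<inter> X closure_of B = {}"
proof -
  obtain U V where UV: "openin X U" "openin X V" "p \<in> U" "q \<in> V" "disjnt U V"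
    using X(2) pq unfolding Hausdorff_space_def by metis
  have r: "\<And>C a. closedin X C \<and> a \<in> topspace X - C
     \<Longrightarrow> \<exists>U. openin X U \<and> a \<in> U \<and> disjnt C (X closure_of U)"
    using X(1) unfolding regular_space by blast
  obtain A where A: "openin X A" "p \<in> A" "disjnt (topspace X - U) (X closure_of A)"
    using r[of "topspace X - U" p] UV(1,3) pq(1) by blast
  obtain B where B: "openin X B" "q \<in> B" "disjnt (topspace X - V) (X closure_of B)"
    using r[of "topspace X - V" q] UV(2,4) pq(2) by blast
  have "X closure_of A \<subseteq> U" "X closure_of B \<subseteq> V"
    using A(3) B(3) closure_of_subset_topspace[of X A] closure_of_subset_topspace[of X B]
    unfolding disjnt_def by blast+
  then have "X closure_of A \<inter> X closure_of B = {}" using UV(5) unfolding disjnt_def by blast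
  then show ?thesis using that A B by blast
qed

text \<open>This is the form of the SUC property that later gets contradicted. The order of choices
  matters: \<open>A\<close> and \<open>B\<close> come from \<open>p\<close> and \<open>q\<close>
  alone, and the neighbourhood \<open>U\<close> found for \<open>x\<close> then serves all
  \<open>g\<close> at once.\<close>

lemma SUC_separation:
  assumes SUC: "SUC_G_space G T X act" and pq: "p \<in> topspace X" "q \<in> topspace X" "p \<noteq> q"
  obtains A B where "openin X A" "openin X B" "p \<in> A" "q \<in> B"
    "\<And>x. x \<in> topspace X \<Longrightarrow> \<exists>U. openin T U \<and> \<one>\<^bsub>G\<^esub> \<in> U \<and>
       (\<forall>g\<in>carrier G. \<forall>u\<in>U. \<not> (act (g \<otimes>\<^bsub>G\<^esub> u) x \<in> A \<and> act g x \<in> B))"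
proof -
  have X: "compact_space X" "Hausdorff_space X" using SUC by (auto simp: SUC_G_space_def)
  obtain A B where AB: "openin X A" "openin X B" "p \<in> A" "q \<in> B"
    "X closure_of A \<inter> X closure_of B = {}"
    using regular_separation[OF compact_Hausdorff_imp_regular_space[OF X] X(2) pq] by metis
  define E where "E = topspace X \<times> topspace X - (X closure_of A) \<times> (X closure_of B)"
  have "closedin (prod_topology X X) ((X closure_of A) \<times> (X closure_of B))"
    by (simp add: closedin_prod_Times_iff)
  then have "openin (prod_topology X X) E"
    unfolding E_def by (metis openin_diff openin_topspace topspace_prod_topology)
  moreover have "Id_on (topspace X) \<subseteq> E" "E \<subseteq> topspace X \<times> topspace X"
    unfolding E_def using AB(5) by auto
  ultimately have "E \<in> the_uniformity X"
    unfolding the_uniformity_eq[OF X] diag_nbhds_def by blast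
  moreover have "A \<subseteq> X closure_of A" "B \<subseteq> X closure_of B"
    using AB(1,2) by (simp_all add: closure_of_subset openin_subset)
  ultimately show ?thesis
    using SUC that[OF AB(1-4)] unfolding SUC_G_space_def E_def by fast
qed

section \<open>Homeomorphisms supported in a subinterval\<close>

interpretation Homeo_plus_group: group Homeo_plus
  by (rule group_Homeo_plus)

lemma Homeo_plus_mult_apply:
  assumes "g \<in> carrier Homeo_plus" "h \<in> carrier Homeo_plus" "x \<in> {0..1}"
  shows "(g \<otimes>\<^bsub>Homeo_plus\<^esub> h) x = g (h x)"
  using mult_Homeo_plus[OF assms(1,2)] assms(3) by (simp add: compose_def)

lemma Homeo_plus_eqI:
  assumes "g \<in> carrier Homeo_plus" "h \<in> carrier Homeo_plus" "\<And>x. x \<in> {0..1} \<Longrightarrow> g x = h x"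
  shows "g = h"
  using extensionalityI[OF Homeo_plusD(1)[OF assms(1)] Homeo_plusD(1)[OF assms(2)]] assms(3) by blast

lemma Homeo_plus_less_iff:
  assumes "g \<in> carrier Homeo_plus" "x \<in> {0..1}" "y \<in> {0..1}"
  shows "g x < g y \<longleftrightarrow> x < y" "g x \<le> g y \<longleftrightarrow> x \<le> y"
proof -
  have "\<And>x y. x \<in> {0..1} \<Longrightarrow> y \<in> {0..1} \<Longrightarrow> x < y \<Longrightarrow> g x < g y"
    using Homeo_plusD(4)[OF assms(1)] by (simp add: strict_mono_on_def)
  then show "g x < g y \<longleftrightarrow> x < y" "g x \<le> g y \<longleftrightarrow> x \<le> y"
    using assms(2,3) by (metis not_less less_le not_less_iff_gr_or_eq)+
qed

lemma Homeo_plus_endpoints: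
  assumes "g \<in> carrier Homeo_plus"
  shows "g 0 = 0" "g 1 = 1"
proof -
  have "0 \<in> g ` {0..1}" "1 \<in> g ` {0..1}" using Homeo_plusD(3)[OF assms] by simp_all
  then obtain x y where "x \<in> {0..1}" "g x = 0" "y \<in> {0..1}" "g y = 1" by (metis imageE)
  then show "g 0 = 0" "g 1 = 1"
    using Homeo_plus_less_iff(2)[OF assms, of 0 x] Homeo_plus_less_iff(2)[OF assms, of y 1]
      Homeo_plusD(7)[OF assms, of 0] Homeo_plusD(7)[OF assms, of 1] by auto
qed

text \<open>Surjectivity is the intermediate value theorem; \<open>restrict\<close> supplies the
  extensionality that the carrier demands.\<close>

lemma Homeo_plusI:
  assumes "continuous_on {0..1} f" "strict_mono_on {0..1} f" "f 0 = 0" "f 1 = 1"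
  shows "restrict f {0..1} \<in> carrier Homeo_plus"
proof -
  have m: "mono_on {0..1} f" using assms(2) by (rule strict_mono_on_imp_mono_on)
  have "f x \<in> {0..1}" if "x \<in> {0..1}" for x
    using m[unfolded mono_on_def, rule_format, of 0 x] m[unfolded mono_on_def, rule_format, of x 1]
      that assms(3,4) by auto
  moreover have "y \<in> f ` {0..1}" if "y \<in> {0..1}" for y
    using IVT'[of f 0 y 1] that assms by auto
  ultimately have "f ` {0..1} = {0..1}" by blast
  moreover have "continuous_on {0..1} (restrict f {0..1})"
    by (rule continuous_on_eq[OF assms(1)]) simp
  ultimately show ?thesis
    using assms(2) by (simp add: carrier_Homeo_plus strict_mono_on_def)
qed

lemma glue_strict_mono_continuous:
  fixes f g :: "real \<Rightarrow> real"
  assumes f: "continuous_on {a..c} f" "strict_mono_on {a..c} f"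
    and g: "continuous_on {c..b} g" "strict_mono_on {c..b} g" and c: "f c = g c" "a \<le> c" "c \<le> b"
  shows "continuous_on {a..b} (\<lambda>x. if x \<le> c then f x else g x)"
    and "strict_mono_on {a..b} (\<lambda>x. if x \<le> c then f x else g x)"
proof -
  have "{x \<in> {a..b}. x \<le> c} = {a..c}" "{x \<in> {a..b}. c \<le> x} = {c..b}" using c by auto
  then show "continuous_on {a..b} (\<lambda>x. if x \<le> c then f x else g x)"
    using f(1) g(1) c(1) by (intro continuous_on_cases_le) auto
  show "strict_mono_on {a..b} (\<lambda>x. if x \<le> c then f x else g x)"
  proof (rule strict_mono_onI)
    fix r s assume rs: "r \<in> {a..b}" "s \<in> {a..b}" "r < s"
    have F: "f x < f y" if "a \<le> x" "x < y" "y \<le> c" for x y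
      using f(2) that by (simp add: strict_mono_on_def)
    have G: "g x < g y" if "c \<le> x" "x < y" "y \<le> b" for x y
      using g(2) that by (simp add: strict_mono_on_def)
    consider "s \<le> c" | "r \<le> c" "c < s" | "c < r" using rs by linarith
    then show "(if r \<le> c then f r else g r) < (if s \<le> c then f s else g s)"
    proof cases
      case 2
      have "f r \<le> f c" using F[of r c] 2 rs by (cases "r = c") auto
      then show ?thesis using G[of c s] 2 rs c by auto
    qed (use F G rs in auto)
  qed
qed

text \<open>Since no order of \<open>a\<close> and \<open>b\<close> is imposed,
  \<open>b \<le> a\<close> gives the trivial group, which starts the induction in
  \<open>fixed_point_near\<close> on the degenerate interval [0, 0].\<close>

definition supported_in :: "real \<Rightarrow> real \<Rightarrow> (real \<Rightarrow> real) set" where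
  "supported_in a b = {g \<in> carrier Homeo_plus. \<forall>x\<in>{0..1}. x \<le> a \<or> b \<le> x \<longrightarrow> g x = x}"

lemma supported_inD:
  assumes "g \<in> supported_in a b"
  shows "g \<in> carrier Homeo_plus" "\<And>x. x \<in> {0..1} \<Longrightarrow> x \<le> a \<or> b \<le> x \<Longrightarrow> g x = x"
  using assms by (auto simp: supported_in_def)

lemma supported_in_mono:
  "a' \<le> a \<Longrightarrow> b \<le> b' \<Longrightarrow> supported_in a b \<subseteq> supported_in a' b'"
  unfolding supported_in_def by fastforce

lemma supported_in_0_1: "supported_in 0 1 = carrier Homeo_plus"
  using Homeo_plus_endpoints by (fastforce simp: supported_in_def)

lemma supported_in_trivial:
  assumes "b \<le> a" shows "supported_in a b \<subseteq> {\<one>\<^bsub>Homeo_plus\<^esub>}"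
proof
  fix g assume g: "g \<in> supported_in a b"
  have "g = \<one>\<^bsub>Homeo_plus\<^esub>"
  proof (rule Homeo_plus_eqI)
    fix x :: real assume x: "x \<in> {0..1}"
    have "x \<le> a \<or> b \<le> x" using assms by linarith
    then show "g x = \<one>\<^bsub>Homeo_plus\<^esub> x" using supported_inD(2)[OF g x] x by (simp add: one_Homeo_plus)
  qed (use supported_inD(1)[OF g] in auto)
  then show "g \<in> {\<one>\<^bsub>Homeo_plus\<^esub>}" by simp
qed

lemma supported_in_maps:
  assumes "g \<in> supported_in a b" "0 \<le> a" "b \<le> 1" "x \<in> {a..b}"
  shows "g x \<in> {a..b}"
proof -
  note g = supported_inD[OF assms(1)]
  have "g a = a" "g b = b" using g(2)[of a] g(2)[of b] assms(2-4) by auto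
  then show ?thesis
    using Homeo_plus_less_iff(2)[OF g(1), of a x] Homeo_plus_less_iff(2)[OF g(1), of x b] assms(2-4) by auto
qed

lemma supported_in_mult:
  assumes g: "g \<in> supported_in a b" and h: "h \<in> supported_in a b"
  shows "g \<otimes>\<^bsub>Homeo_plus\<^esub> h \<in> supported_in a b"
  using Homeo_plus_group.m_closed[OF supported_inD(1)[OF g] supported_inD(1)[OF h]]
    Homeo_plus_mult_apply[OF supported_inD(1)[OF g] supported_inD(1)[OF h]]
    supported_inD(2)[OF g] supported_inD(2)[OF h]
  unfolding supported_in_def by auto

lemma supported_in_inv:
  assumes g: "g \<in> supported_in a b"
  shows "inv\<^bsub>Homeo_plus\<^esub> g \<in> supported_in a b"
  using Homeo_plus_group.inv_closed[OF supported_inD(1)[OF g]]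
    inv_Homeo_plus(2)[OF supported_inD(1)[OF g]] supported_inD(2)[OF g]
  unfolding supported_in_def by fastforce

section \<open>Constructing and decomposing homeomorphisms with given support\<close>

lemma extend_supported_in:
  assumes ab: "0 \<le> a" "a \<le> b" "b \<le> 1"
    and f: "continuous_on {a..b} f" "strict_mono_on {a..b} f" "f a = a" "f b = b"
  obtains g where "g \<in> supported_in a b" "\<And>x. x \<in> {a..b} \<Longrightarrow> g x = f x"
proof -
  have id: "continuous_on S (\<lambda>x. x)" "strict_mono_on S (\<lambda>x. x)" for S :: "real set"
    by (auto intro: continuous_on_id strict_mono_onI)
  \<comment> \<open>The identity is glued on at \<open>b\<close> first, and then at
    \<open>a\<close>.\<close>
  let ?k = "\<lambda>x. if x \<le> b then f x else x"
  have k: "continuous_on {a..1} ?k" "strict_mono_on {a..1} ?k"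
    by (rule glue_strict_mono_continuous; use ab f id in simp)+
  let ?l = "\<lambda>x. if x \<le> a then x else ?k x"
  have l: "continuous_on {0..1} ?l" "strict_mono_on {0..1} ?l"
    by (rule glue_strict_mono_continuous; use ab f id k in simp)+
  have "restrict ?l {0..1} \<in> carrier Homeo_plus"
    by (rule Homeo_plusI[OF l]) (use ab f in auto)
  then have "restrict ?l {0..1} \<in> supported_in a b"
    using ab f by (auto simp: supported_in_def)
  moreover have "restrict ?l {0..1} x = f x" if "x \<in> {a..b}" for x using that ab f by auto
  ultimately show ?thesis by (rule that)
qed

text \<open>This is the power map with exponent \<open>r\<close> on [0, 1], moved to [a, b] by
  affine rescaling. One family supplies both the transitivity on the open interval and, for growing
  exponents, the contractions towards \<open>a\<close>.\<close>

lemma power_map: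
  assumes ab: "0 \<le> a" "a < b" "b \<le> 1" and r: "r > 0"
  obtains g where "g \<in> supported_in a b"
    "\<And>x. x \<in> {a..b} \<Longrightarrow> g x = a + (b - a) * ((x - a) / (b - a)) powr r"
proof -
  let ?f = "\<lambda>x. a + (b - a) * ((x - a) / (b - a)) powr r"
  have "continuous_on {a..b} (\<lambda>x. ((x - a) / (b - a)) powr r)"
    by (rule continuous_on_powr') (use ab r in \<open>auto intro!: continuous_intros\<close>)
  then have c: "continuous_on {a..b} ?f"
    by (intro continuous_on_add continuous_on_mult continuous_on_const)
  have m: "strict_mono_on {a..b} ?f"
  proof (rule strict_mono_onI)
    fix x y assume xy: "x \<in> {a..b}" "y \<in> {a..b}" "x < y"
    have "(x - a) / (b - a) < (y - a) / (b - a)" "0 \<le> (x - a) / (b - a)"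
      using xy ab by (auto intro: divide_strict_right_mono)
    then have "((x - a) / (b - a)) powr r < ((y - a) / (b - a)) powr r"
      using r by (intro powr_less_mono2)
    then show "?f x < ?f y" using ab by simp
  qed
  have "?f a = a" "?f b = b" using ab r by auto
  then obtain g where "g \<in> supported_in a b" "\<And>x. x \<in> {a..b} \<Longrightarrow> g x = ?f x"
    using extend_supported_in[OF ab(1) less_imp_le[OF ab(2)] ab(3) c m] by metis
  then show ?thesis by (rule that)
qed

text \<open>A power map does it: in rescaled coordinates the exponent has to be the logarithm of
  \<open>t\<close> to the base \<open>s\<close>, which is positive because both numbers lie strictly
  between 0 and 1.\<close>

lemma supported_in_transitive:
  assumes ab: "0 \<le> a" "b \<le> 1" and st: "s \<in> {a<..<b}" "t \<in> {a<..<b}"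
  obtains g where "g \<in> supported_in a b" "g s = t"
proof -
  let ?s = "(s - a) / (b - a)" and ?t = "(t - a) / (b - a)"
  have s: "0 < ?s" "?s < 1" and t: "0 < ?t" "?t < 1" using st by auto
  define r where "r = ln ?t / ln ?s"
  have "ln ?s < 0" "ln ?t < 0" using s t by (simp_all add: ln_less_zero)
  then have r: "r > 0" "r * ln ?s = ln ?t" unfolding r_def by (auto simp: divide_neg_neg)
  have "?s powr r = exp (r * ln ?s)" using s by (auto simp: powr_def)
  also have "\<dots> = ?t" using t(1) unfolding r(2) by (rule exp_ln)
  finally have "?s powr r = ?t" .
  then have "a + (b - a) * ?s powr r = t" using st by simp
  moreover have "a < b" using st by simp
  ultimately show ?thesis using power_map[OF ab(1) _ ab(2) r(1)] st that
    by (metis atLeastAtMost_iff greaterThanLessThan_iff less_imp_le)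
qed

text \<open>Both maps preserve each side of \<open>c\<close>, and on each side one of them is the
  identity.\<close>

lemma supported_in_commute:
  assumes g: "g \<in> supported_in a c" and h: "h \<in> supported_in c b" and c: "c \<in> {0..1}"
  shows "g \<otimes>\<^bsub>Homeo_plus\<^esub> h = h \<otimes>\<^bsub>Homeo_plus\<^esub> g"
proof (rule Homeo_plus_eqI)
  note G = supported_inD[OF g] and H = supported_inD[OF h]
  show "g \<otimes>\<^bsub>Homeo_plus\<^esub> h \<in> carrier Homeo_plus" "h \<otimes>\<^bsub>Homeo_plus\<^esub> g \<in> carrier Homeo_plus"
    using G(1) H(1) by simp_all
  fix x :: real assume x: "x \<in> {0..1}"
  have gx: "g x \<in> {0..1}" and hx: "h x \<in> {0..1}" using Homeo_plusD(7) G(1) H(1) x by blast+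
  have "g (h x) = h (g x)"
  proof (cases "x \<le> c")
    case True
    then have "g x \<le> g c" using Homeo_plus_less_iff(2)[OF G(1) x c] by simp
    then have "g x \<le> c" using G(2)[OF c] by simp
    then show ?thesis using True H(2)[OF gx] H(2)[OF x] by simp
  next
    case False
    then have "h c \<le> h x" using Homeo_plus_less_iff(2)[OF H(1) c x] by simp
    then have "c \<le> h x" using H(2)[OF c] by simp
    then show ?thesis using False G(2)[OF hx] G(2)[OF x] by simp
  qed
  then show "(g \<otimes>\<^bsub>Homeo_plus\<^esub> h) x = (h \<otimes>\<^bsub>Homeo_plus\<^esub> g) x"
    using Homeo_plus_mult_apply[OF G(1) H(1) x] Homeo_plus_mult_apply[OF H(1) G(1) x] by simp
qed

text \<open>As \<open>m\<close> fixes \<open>a\<close>, \<open>c\<close> and \<open>b\<close>, its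
  restrictions to [a, c] and [c, b] extend by the identity.\<close>

lemma supported_in_split:
  assumes m: "m \<in> supported_in a b" and c: "m c = c" and abc: "0 \<le> a" "a \<le> c" "c \<le> b" "b \<le> 1"
  obtains g h where "g \<in> supported_in a c" "h \<in> supported_in c b" "m = g \<otimes>\<^bsub>Homeo_plus\<^esub> h"
proof -
  note M = supported_inD[OF m]
  have ab: "m a = a" "m b = b" using M(2)[of a] M(2)[of b] abc by auto
  have mc: "continuous_on {s..t} m" "strict_mono_on {s..t} m" if "0 \<le> s" "t \<le> 1" for s t
  proof -
    have "{s..t} \<subseteq> {0..1}" using that by auto
    then show "continuous_on {s..t} m" "strict_mono_on {s..t} m"
      using Homeo_plusD(2,4)[OF M(1)] by (auto intro: continuous_on_subset monotone_on_subset)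
  qed
  have le: "0 \<le> a" "a \<le> c" "c \<le> 1" "0 \<le> c" "c \<le> b" "b \<le> 1" using abc by auto
  obtain g where g: "g \<in> supported_in a c" "\<And>x. x \<in> {a..c} \<Longrightarrow> g x = m x"
    using extend_supported_in[OF le(1-3) mc[OF le(1,3)] ab(1) c] by metis
  obtain h where h: "h \<in> supported_in c b" "\<And>x. x \<in> {c..b} \<Longrightarrow> h x = m x"
    using extend_supported_in[OF le(4-6) mc[OF le(4,6)] c ab(2)] by metis
  note G = supported_inD[OF g(1)] and H = supported_inD[OF h(1)]
  have "m = g \<otimes>\<^bsub>Homeo_plus\<^esub> h"
  proof (rule Homeo_plus_eqI[OF M(1)])
    show "g \<otimes>\<^bsub>Homeo_plus\<^esub> h \<in> carrier Homeo_plus" using G(1) H(1) by simp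
    fix x :: real assume x: "x \<in> {0..1}"
    have hx: "h x \<in> {0..1}" using Homeo_plusD(7) H(1) x by blast
    consider "x \<le> a" | "a \<le> x" "x \<le> c" | "c \<le> x" "x \<le> b" | "b \<le> x" by linarith
    then have "m x = g (h x)"
    proof cases
      case 3
      then have "h x \<in> {c..b}" using supported_in_maps[OF h(1)] abc by simp
      then show ?thesis using 3 h(2)[of x] G(2)[OF hx] by simp
    qed (use G(2)[OF x] H(2)[OF x] M(2)[OF x] g(2) abc in auto)
    then show "m x = (g \<otimes>\<^bsub>Homeo_plus\<^esub> h) x" using Homeo_plus_mult_apply[OF G(1) H(1) x] by simp
  qed
  then show ?thesis using that g(1) h(1) by blast
qed

section \<open>Approximation in the supremum metric\<close>

lemma Homeo_plus_open_ball:
  assumes "openin Homeo_plus_topology U" "g \<in> U"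
  obtains r where "r > 0" "\<And>h. h \<in> carrier Homeo_plus \<Longrightarrow> Homeo_plus_dist g h < r \<Longrightarrow> h \<in> U"
proof -
  have "g \<in> carrier Homeo_plus" "\<exists>r>0. Homeo_plus.mball g r \<subseteq> U"
    using assms unfolding Homeo_plus_topology_eq Homeo_plus.openin_mtopology by blast+
  then show ?thesis using that by (auto simp: subset_iff)
qed

text \<open>Conjugation by \<open>h n\<close> moves the region where \<open>u\<close> acts to the
  preimage of [c, b] under \<open>h n\<close>. High powers push any given point of the open interval
  below \<open>c\<close>, so this preimage shrinks towards \<open>b\<close>.\<close>

lemma power_maps_conjugate_to_one:
  assumes ab: "0 \<le> a" "a < b" "b \<le> 1"
  obtains h :: "nat \<Rightarrow> real \<Rightarrow> real" where "\<And>n. h n \<in> supported_in a b"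
    and "\<And>u c U. u \<in> supported_in c b \<Longrightarrow> a < c \<Longrightarrow> openin Homeo_plus_topology U \<Longrightarrow> \<one>\<^bsub>Homeo_plus\<^esub> \<in> U \<Longrightarrow>
       \<exists>n\<^sub>0. \<forall>n\<ge>n\<^sub>0. inv\<^bsub>Homeo_plus\<^esub> h n \<otimes>\<^bsub>Homeo_plus\<^esub> (u \<otimes>\<^bsub>Homeo_plus\<^esub> h n) \<in> U"
proof -
  \<comment> \<open>The exponent n + 1 is positive even for n = 0, as \<open>power_map\<close>
    requires.\<close>
  have "\<exists>g. g \<in> supported_in a b \<and>
      (\<forall>x\<in>{a..b}. g x = a + (b - a) * ((x - a) / (b - a)) powr real (Suc n))" for n
    using power_map[OF ab, of "real (Suc n)"] by (metis of_nat_0_less_iff zero_less_Suc)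
  then obtain h where h: "\<And>n. h n \<in> supported_in a b"
    "\<And>n x. x \<in> {a..b} \<Longrightarrow> h n x = a + (b - a) * ((x - a) / (b - a)) powr real (Suc n)"
    by metis
  have "\<exists>n\<^sub>0. \<forall>n\<ge>n\<^sub>0. inv\<^bsub>Homeo_plus\<^esub> h n \<otimes>\<^bsub>Homeo_plus\<^esub> (u \<otimes>\<^bsub>Homeo_plus\<^esub> h n) \<in> U"
    if u: "u \<in> supported_in c b" and c: "a < c"
      and U: "openin Homeo_plus_topology U" "\<one>\<^bsub>Homeo_plus\<^esub> \<in> U" for u c U
  proof -
    obtain r where r: "r > 0" "\<And>g. g \<in> carrier Homeo_plus \<Longrightarrow> Homeo_plus_dist \<one>\<^bsub>Homeo_plus\<^esub> g < r \<Longrightarrow> g \<in> U"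
      using Homeo_plus_open_ball[OF U] by metis
    \<comment> \<open>From \<open>p\<close> to \<open>b\<close> a length of at most r / 2 is left,
      which bounds the displacement there; the midpoint keeps \<open>p\<close> to the right of
      \<open>a\<close>.\<close>
    define p where "p = max ((a + b) / 2) (b - r / 2)"
    have p: "a < p" "p < b" "b - p \<le> r / 2" using ab r(1) by (auto simp: p_def max_def field_simps)
    define t where "t = (p - a) / (b - a)"
    have t: "0 < t" "t < 1" using p ab by (auto simp: t_def)
    \<comment> \<open>This bound puts \<open>h n p\<close> below \<open>c\<close> for all later
      \<open>n\<close>.\<close>
    obtain n\<^sub>0 where n0: "t ^ n\<^sub>0 < (c - a) / (b - a)"
      using real_arch_pow_inv[of "(c - a) / (b - a)" t] c ab t by auto
    have "inv\<^bsub>Homeo_plus\<^esub> h n \<otimes>\<^bsub>Homeo_plus\<^esub> (u \<otimes>\<^bsub>Homeo_plus\<^esub> h n) \<in> U" if n: "n \<ge> n\<^sub>0" for n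
    proof -
      let ?v = "inv\<^bsub>Homeo_plus\<^esub> h n \<otimes>\<^bsub>Homeo_plus\<^esub> (u \<otimes>\<^bsub>Homeo_plus\<^esub> h n)"
      have ub: "u \<in> supported_in a b" using u c supported_in_mono[of a c b b] by auto
      have v: "?v \<in> supported_in a b"
        by (intro supported_in_mult supported_in_inv h(1) ub)
      note H = supported_inD[OF h(1)[of n]] and V = supported_inD[OF v]
      have "t powr real (Suc n) = t ^ Suc n" using t(1) by (rule powr_realpow)
      also have "\<dots> \<le> t ^ n\<^sub>0" using t n by (intro power_decreasing) auto
      finally have "t powr real (Suc n) < (c - a) / (b - a)" using n0 by linarith
      then have "(b - a) * t powr real (Suc n) < c - a" using ab by (simp add: field_simps)
      moreover have "h n p = a + (b - a) * t powr real (Suc n)" using h(2)[of p n] p by (simp add: t_def)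
      ultimately have hp: "h n p < c" by linarith
      have vx: "?v x = (inv\<^bsub>Homeo_plus\<^esub> h n) (u (h n x))" if "x \<in> {0..1}" for x
        using that supported_inD(1)[OF u] H(1) Homeo_plusD(7)[OF H(1) that]
        by (simp add: Homeo_plus_mult_apply)
      have low: "?v x = x" if x: "x \<in> {0..1}" "x \<le> p" for x
      proof -
        have "h n x \<le> h n p" using x p ab Homeo_plus_less_iff(2)[OF H(1), of x p] by simp
        then have "u (h n x) = h n x"
          using supported_inD(2)[OF u, of "h n x"] Homeo_plusD(7)[OF H(1) x(1)] hp by auto
        then show ?thesis using vx[OF x(1)] inv_Homeo_plus(2)[OF H(1) x(1)] by simp
      qed
      have "\<bar>\<one>\<^bsub>Homeo_plus\<^esub> x - ?v x\<bar> \<le> r / 2" if x: "x \<in> {0..1}" for x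
      proof -
        \<comment> \<open>The conjugate fixes everything up to \<open>p\<close> and from
          \<open>b\<close> on, hence maps [p, b] to itself.\<close>
        have "\<bar>x - ?v x\<bar> \<le> r / 2"
        proof (cases "p \<le> x \<and> x \<le> b")
          case True
          then have "?v p \<le> ?v x" using x p ab Homeo_plus_less_iff(2)[OF V(1), of p x] by simp
          then have "p \<le> ?v x" using low[of p] p ab by simp
          moreover have "?v x \<le> b" using supported_in_maps[OF v, of x] True p ab by simp
          ultimately show ?thesis using True p(3) by linarith
        next
          case False
          then have "?v x = x" using low[OF x] V(2)[OF x] by (cases "x \<le> p") auto
          then show ?thesis using r(1) by simp
        qed
        then show ?thesis using x by (simp add: one_Homeo_plus)
      qed
      then have "Homeo_plus_dist \<one>\<^bsub>Homeo_plus\<^esub> ?v \<le> r / 2"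
        using Homeo_plus_dist_le[OF Homeo_plus_group.one_closed V(1)] by blast
      then show ?thesis using r(2)[OF V(1)] r(1) by simp
    qed
    then show ?thesis by blast
  qed
  then show ?thesis using that h(1) by blast
qed

text \<open>The map \<open>v\<close> is the identity up to \<open>c\<close>, linear on [c, q] and
  equal to \<open>u\<close> from \<open>q\<close> on. Little changes near \<open>a\<close>, since
  both maps send [a, q] into [a, u q], an interval shorter than r / 2.\<close>

lemma approximate_by_identity_near_left_end:
  assumes ab: "0 \<le> a" "a < b" "b \<le> 1" and u: "u \<in> supported_in a b" and r: "r > 0"
  obtains c v where "a < c" "v \<in> supported_in c b" "Homeo_plus_dist u v < r"
proof -
  note D = supported_inD[OF u]
  have ua: "u a = a" "u b = b" using D(2)[of a] D(2)[of b] ab by auto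
  obtain d where d: "d > 0" "\<And>x y. x \<in> {0..1} \<Longrightarrow> y \<in> {0..1} \<Longrightarrow> \<bar>x - y\<bar> < d \<Longrightarrow> \<bar>u x - u y\<bar> < r / 2"
    using Homeo_plus_unif[OF D(1), of "r / 2"] r by auto
  define q where "q = a + min (min (d / 2) (r / 2)) ((b - a) / 2)"
  have q: "a < q" "q < b" "q - a \<le> r / 2" "\<bar>q - a\<bar> < d" using d(1) r ab by (auto simp: q_def min_def field_simps)
  have uq: "a < u q" "u q - a < r / 2"
    using Homeo_plus_less_iff(1)[OF D(1), of a q] d(2)[of q a] q ab ua by auto
  \<comment> \<open>Lying below both \<open>q\<close> and \<open>u q\<close> makes the linear piece
    from (c, c) to (q, u q) increasing.\<close>
  define c where "c = a + min (q - a) (u q - a) / 2"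
  have c: "a < c" "c < q" "c < u q" using q uq by (auto simp: c_def min_def field_simps)
  let ?l = "\<lambda>x. c + (u q - c) / (q - c) * (x - c)"
  let ?f = "\<lambda>x. if x \<le> q then ?l x else u x"
  have "{q..b} \<subseteq> {0..1}" using q ab by auto
  then have uc: "continuous_on {q..b} u" "strict_mono_on {q..b} u"
    using Homeo_plusD(2,4)[OF D(1)] by (auto intro: continuous_on_subset monotone_on_subset)
  have l: "continuous_on {c..q} ?l" "strict_mono_on {c..q} ?l"
    using c by (auto intro!: continuous_intros strict_mono_onI mult_strict_left_mono divide_strict_right_mono)
  have lq: "?l q = u q" using c by simp
  have f: "continuous_on {c..b} ?f" "strict_mono_on {c..b} ?f"
    by (rule glue_strict_mono_continuous[OF l uc lq]; use c q in simp)+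
  have f': "?f c = c" "?f b = b" using c q ua by simp_all
  have cb: "0 \<le> c" "c \<le> b" using c q ab by simp_all
  obtain v where v: "v \<in> supported_in c b" "\<And>x. x \<in> {c..b} \<Longrightarrow> v x = ?f x"
    using extend_supported_in[OF cb ab(3) f f'] by metis
  note V = supported_inD[OF v(1)]
  have eq: "v x = u x" if "q \<le> x" "x \<le> b" for x
  proof (cases "x = q")
    case True
    then show ?thesis using v(2)[of q] lq c q by simp
  next
    case False
    then show ?thesis using v(2)[of x] that c q by simp
  qed
  have "\<bar>u x - v x\<bar> \<le> r / 2" if x: "x \<in> {0..1}" for x
  proof -
    consider "x \<le> a" | "a \<le> x" "x \<le> q" | "q \<le> x" "x \<le> b" | "b \<le> x" by linarith
    then show ?thesis
    proof cases
      case 2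
      have I: "a \<in> {0..1}" "q \<in> {0..1}" using q ab by auto
      have "u a \<le> u x" "u x \<le> u q" "v a \<le> v x" "v x \<le> v q"
        using 2 Homeo_plus_less_iff(2)[OF D(1)] Homeo_plus_less_iff(2)[OF V(1)] x I by blast+
      moreover have "v q = u q" "v a = a" using eq[of q] V(2)[of a] q I(1) c(1) by simp_all
      ultimately show ?thesis using ua(1) uq(2) by linarith
    qed (use D(2)[OF x] V(2)[OF x] c r eq[of x] in auto)
  qed
  then have "Homeo_plus_dist u v \<le> r / 2" using Homeo_plus_dist_le[OF D(1) V(1)] by blast
  then have "Homeo_plus_dist u v < r" using r by linarith
  then show ?thesis using that c(1) v(1) by blast
qed

text \<open>All displacements of \<open>m\<close> get scaled by \<open>s\<close> and keep their
  direction, which provides elements near the identity. Strict monotonicity comes from the term (1 -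
  s) x.\<close>

lemma convex_combination_with_identity:
  assumes m: "m \<in> supported_in a b" and s: "0 \<le> s" "s < 1"
  obtains u where "u \<in> supported_in a b" "\<And>x. x \<in> {0..1} \<Longrightarrow> u x = x + s * (m x - x)"
proof -
  note M = supported_inD[OF m]
  let ?f = "\<lambda>x. x + s * (m x - x)"
  have c: "continuous_on {0..1} ?f"
    using Homeo_plusD(2)[OF M(1)] by (intro continuous_intros)
  have "strict_mono_on {0..1} ?f"
  proof (rule strict_mono_onI)
    fix x y :: real assume xy: "x \<in> {0..1}" "y \<in> {0..1}" "x < y"
    have "s * m x \<le> s * m y"
      using s xy Homeo_plus_less_iff(2)[OF M(1) xy(1,2)] by (intro mult_left_mono) auto
    moreover have "(1 - s) * x < (1 - s) * y" using s xy by simp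
    ultimately show "?f x < ?f y" by (simp add: algebra_simps)
  qed
  then have "restrict ?f {0..1} \<in> carrier Homeo_plus"
    using Homeo_plus_endpoints[OF M(1)] by (intro Homeo_plusI c) auto
  then have "restrict ?f {0..1} \<in> supported_in a b"
    using M(2) by (simp add: supported_in_def)
  then show ?thesis using that by auto
qed

section \<open>Triviality of the compact SUC spaces\<close>

locale Homeo_plus_SUC_space =
  fixes Y :: "'y topology" and act :: "(real \<Rightarrow> real) \<Rightarrow> 'y \<Rightarrow> 'y"
  assumes SUC: "SUC_G_space Homeo_plus Homeo_plus_topology Y act"
begin

lemma G_space_Y: "G_space Homeo_plus Homeo_plus_topology Y act"
  and compact_Y: "compact_space Y" and Hausdorff_Y: "Hausdorff_space Y"
  using SUC by (auto simp: SUC_G_space_def)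

lemmas act_closed = G_space_act_closed[OF G_space_Y]

lemma act_mult:
  "g \<in> carrier Homeo_plus \<Longrightarrow> h \<in> carrier Homeo_plus \<Longrightarrow> y \<in> topspace Y \<Longrightarrow>
    act (g \<otimes>\<^bsub>Homeo_plus\<^esub> h) y = act g (act h y)"
  and act_one: "y \<in> topspace Y \<Longrightarrow> act \<one>\<^bsub>Homeo_plus\<^esub> y = y"
  using G_space_Y by (simp_all add: G_space_def)

text \<open>Let \<open>h n\<close> contract towards \<open>a\<close>. For \<open>u\<close> trivial near \<open>a\<close> we have \<open>u (h n) = (h n) (v n)\<close>
  with \<open>v n\<close> tending to the identity, so by the SUC property \<open>u\<close> fixes every cluster point of the
  orbit sequence \<open>h n z\<close>; such \<open>u\<close> are dense.\<close>

lemma fixed_point_in_orbit_closure: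
  assumes z: "z \<in> topspace Y" and ab: "0 \<le> a" "a < b" "b \<le> 1"
  obtains w where "w \<in> Y closure_of ((\<lambda>g. act g z) ` supported_in a b)"
    "\<And>g. g \<in> supported_in a b \<Longrightarrow> act g w = w"
proof -
  obtain h :: "nat \<Rightarrow> real \<Rightarrow> real" where h: "\<And>n. h n \<in> supported_in a b"
    "\<And>u c U. u \<in> supported_in c b \<Longrightarrow> a < c \<Longrightarrow> openin Homeo_plus_topology U \<Longrightarrow> \<one>\<^bsub>Homeo_plus\<^esub> \<in> U \<Longrightarrow>
       \<exists>n\<^sub>0. \<forall>n\<ge>n\<^sub>0. inv\<^bsub>Homeo_plus\<^esub> h n \<otimes>\<^bsub>Homeo_plus\<^esub> (u \<otimes>\<^bsub>Homeo_plus\<^esub> h n) \<in> U"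
    using power_maps_conjugate_to_one[OF ab] by metis
  note hc = supported_inD(1)[OF h(1)]
  obtain w where w: "w \<in> topspace Y" "\<And>W n. openin Y W \<Longrightarrow> w \<in> W \<Longrightarrow> \<exists>m\<ge>n. act (h m) z \<in> W"
    using compact_space_cluster_point[OF compact_Y, of "\<lambda>n. act (h n) z"] act_closed[OF hc z] by metis
  have fixed: "act u w = w" if u: "u \<in> supported_in c b" and c: "a < c" for u c
  proof (rule ccontr)
    assume neq: "act u w \<noteq> w"
    have uc: "u \<in> carrier Homeo_plus" using supported_inD(1)[OF u] .
    obtain A B where AB: "openin Y A" "openin Y B" "act u w \<in> A" "w \<in> B"
      "\<And>x. x \<in> topspace Y \<Longrightarrow> \<exists>U. openin Homeo_plus_topology U \<and> \<one>\<^bsub>Homeo_plus\<^esub> \<in> U \<and>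
       (\<forall>g\<in>carrier Homeo_plus. \<forall>u\<in>U. \<not> (act (g \<otimes>\<^bsub>Homeo_plus\<^esub> u) x \<in> A \<and> act g x \<in> B))"
      using SUC_separation[OF SUC act_closed[OF uc w(1)] w(1) neq] by metis
    \<comment> \<open>The SUC property is used at the starting point \<open>z\<close> rather than at
      \<open>w\<close>; the maps \<open>h n\<close> take the place of the arbitrary group
      element.\<close>
    obtain U where U: "openin Homeo_plus_topology U" "\<one>\<^bsub>Homeo_plus\<^esub> \<in> U"
      "\<And>g u. g \<in> carrier Homeo_plus \<Longrightarrow> u \<in> U \<Longrightarrow> \<not> (act (g \<otimes>\<^bsub>Homeo_plus\<^esub> u) z \<in> A \<and> act g z \<in> B)"
      using AB(5)[OF z] by blast
    obtain n\<^sub>0 where n0: "\<And>n. n \<ge> n\<^sub>0 \<Longrightarrow> inv\<^bsub>Homeo_plus\<^esub> h n \<otimes>\<^bsub>Homeo_plus\<^esub> (u \<otimes>\<^bsub>Homeo_plus\<^esub> h n) \<in> U"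
      using h(2)[OF u c U(1,2)] by blast
    \<comment> \<open>The cluster point property for this neighbourhood of \<open>w\<close> puts
      \<open>h n z\<close> into \<open>B\<close> and its image under \<open>u\<close> into
      \<open>A\<close> for the same late \<open>n\<close>.\<close>
    have "openin Y (B \<inter> {x \<in> topspace Y. act u x \<in> A})"
      using openin_continuous_map_preimage[OF G_space_act_continuous(1)[OF G_space_Y uc] AB(1)] AB(2) by blast
    then obtain n where n: "n \<ge> n\<^sub>0" "act (h n) z \<in> B" "act u (act (h n) z) \<in> A"
      using w(2)[of "B \<inter> {x \<in> topspace Y. act u x \<in> A}" n\<^sub>0] AB(3,4) w(1) by blast
    have "h n \<otimes>\<^bsub>Homeo_plus\<^esub> (inv\<^bsub>Homeo_plus\<^esub> h n \<otimes>\<^bsub>Homeo_plus\<^esub> (u \<otimes>\<^bsub>Homeo_plus\<^esub> h n)) = u \<otimes>\<^bsub>Homeo_plus\<^esub> h n"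
      using uc hc[of n] by (simp add: Homeo_plus_group.m_assoc[symmetric])
    then show False
      using U(3)[OF hc[of n] n0[OF n(1)]] n(2,3) act_mult[OF uc hc[of n] z] by simp
  qed
  have "act u w = w" if u: "u \<in> supported_in a b" for u
  proof (rule ccontr)
    assume neq: "act u w \<noteq> w"
    \<comment> \<open>The stabilizer of \<open>w\<close> is closed, so a \<open>u\<close> moving
      \<open>w\<close> would have a whole ball of such maps around it, and that ball contains a map
      that is the identity near \<open>a\<close>.\<close>
    let ?S = "{g \<in> topspace Homeo_plus_topology. act g w = w}"
    have top: "topspace Homeo_plus_topology = carrier Homeo_plus"
      using topological_group_Homeo_plus by (simp add: topological_group_def)
    have "openin Homeo_plus_topology (topspace Homeo_plus_topology - ?S)"
      using closedin_stabilizer[OF G_space_Y Hausdorff_Y w(1)] by blast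
    moreover have "u \<in> topspace Homeo_plus_topology - ?S"
      using neq supported_inD(1)[OF u] top by simp
    ultimately obtain r where r: "r > 0"
      "\<And>v. v \<in> carrier Homeo_plus \<Longrightarrow> Homeo_plus_dist u v < r \<Longrightarrow> v \<in> topspace Homeo_plus_topology - ?S"
      using Homeo_plus_open_ball by metis
    obtain c v where "a < c" "v \<in> supported_in c b" "Homeo_plus_dist u v < r"
      using approximate_by_identity_near_left_end[OF ab u r(1)] by metis
    then show False using fixed r(2)[of v] supported_inD(1)[of v c b] by auto
  qed
  moreover have "w \<in> Y closure_of ((\<lambda>g. act g z) ` supported_in a b)"
    unfolding in_closure_of using w h(1) by blast
  ultimately show ?thesis using that by blast
qed

text \<open>If \<open>m\<close> moves \<open>c\<close>, a small \<open>u\<close> moving \<open>c\<close> in the same direction is expanded by some \<open>g\<close> fixing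
  \<open>z\<close> so that \<open>g u\<close> and \<open>m\<close> agree at \<open>c\<close>; then \<open>g u z = m z\<close> and \<open>g z = z\<close>, against the SUC property.\<close>

lemma fixed_by_adjacent_intervals:
  assumes z: "z \<in> topspace Y" and abc: "0 \<le> a" "a \<le> c" "c \<le> b" "b \<le> 1"
    and ac: "\<And>g. g \<in> supported_in a c \<Longrightarrow> act g z = z"
    and cb: "\<And>g. g \<in> supported_in c b \<Longrightarrow> act g z = z"
    and m: "m \<in> supported_in a b"
  shows "act m z = z"
proof -
  \<comment> \<open>Such a \<open>k\<close> splits at \<open>c\<close> into two factors, each fixing
    \<open>z\<close>.\<close>
  have fix_c: "act k z = z" if k: "k \<in> supported_in a b" "k c = c" for k
  proof -
    obtain g h where gh: "g \<in> supported_in a c" "h \<in> supported_in c b" "k = g \<otimes>\<^bsub>Homeo_plus\<^esub> h"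
      using supported_in_split[OF k abc] by metis
    show ?thesis
      using act_mult[OF supported_inD(1)[OF gh(1)] supported_inD(1)[OF gh(2)] z]
        ac[OF gh(1)] cb[OF gh(2)] gh(3) by simp
  qed
  note M = supported_inD[OF m]
  have cI: "c \<in> {0..1}" using abc by auto
  show ?thesis
  proof (rule ccontr)
    assume neq: "act m z \<noteq> z"
    then have mc: "m c \<noteq> c" using fix_c m by blast
    then have c: "a < c" "c < b" using M(2)[OF cI] by (meson not_le)+
    obtain A B where AB: "act m z \<in> A" "z \<in> B"
      "\<And>x. x \<in> topspace Y \<Longrightarrow> \<exists>U. openin Homeo_plus_topology U \<and> \<one>\<^bsub>Homeo_plus\<^esub> \<in> U \<and>
       (\<forall>g\<in>carrier Homeo_plus. \<forall>u\<in>U. \<not> (act (g \<otimes>\<^bsub>Homeo_plus\<^esub> u) x \<in> A \<and> act g x \<in> B))"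
      using SUC_separation[OF SUC act_closed[OF M(1) z] z neq] by metis
    obtain U where U: "openin Homeo_plus_topology U" "\<one>\<^bsub>Homeo_plus\<^esub> \<in> U"
      "\<And>g u. g \<in> carrier Homeo_plus \<Longrightarrow> u \<in> U \<Longrightarrow> \<not> (act (g \<otimes>\<^bsub>Homeo_plus\<^esub> u) z \<in> A \<and> act g z \<in> B)"
      using AB(3)[OF z] by blast
    obtain r where r: "r > 0" "\<And>g. g \<in> carrier Homeo_plus \<Longrightarrow> Homeo_plus_dist \<one>\<^bsub>Homeo_plus\<^esub> g < r \<Longrightarrow> g \<in> U"
      using Homeo_plus_open_ball[OF U(1,2)] by metis
    \<comment> \<open>The bound 1 / 2 keeps \<open>s\<close> below 1; the bound r / 2 keeps
      \<open>u\<close> close to the identity, because \<open>m\<close> displaces no point by more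
      than 1.\<close>
    define s where "s = min (1 / 2) (r / 2)"
    have s: "0 < s" "s < 1" "s \<le> r / 2" using r(1) by (auto simp: s_def)
    obtain u where u: "u \<in> supported_in a b" "\<And>x. x \<in> {0..1} \<Longrightarrow> u x = x + s * (m x - x)"
      using convex_combination_with_identity[OF m less_imp_le[OF s(1)] s(2)] by metis
    note Uc = supported_inD(1)[OF u(1)]
    have "\<bar>\<one>\<^bsub>Homeo_plus\<^esub> x - u x\<bar> \<le> r / 2" if x: "x \<in> {0..1}" for x
    proof -
      have "\<bar>m x - x\<bar> \<le> 1" using Homeo_plusD(7)[OF M(1) x] x by auto
      then have "s * \<bar>m x - x\<bar> \<le> s" using s(1) by (simp add: mult_left_le)
      moreover have "\<bar>s * (m x - x)\<bar> = s * \<bar>m x - x\<bar>" using s(1) by (simp add: abs_mult)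
      ultimately have "\<bar>s * (m x - x)\<bar> \<le> r / 2" using s(3) by linarith
      then show ?thesis using x u(2)[OF x] by (simp add: one_Homeo_plus)
    qed
    then have "Homeo_plus_dist \<one>\<^bsub>Homeo_plus\<^esub> u \<le> r / 2"
      using Homeo_plus_dist_le[OF Homeo_plus_group.one_closed Uc] by blast
    then have uU: "u \<in> U" using r(2)[OF Uc] r(1) by simp
    \<comment> \<open>The point \<open>u c\<close> lies strictly between \<open>c\<close> and
      \<open>m c\<close>, so both \<open>u c\<close> and \<open>m c\<close> are inside one of the
      two open intervals, where transitivity gives \<open>g\<close> among the maps fixing
      \<open>z\<close>.\<close>
    have "\<exists>g. g \<in> supported_in a b \<and> act g z = z \<and> g (u c) = m c"
    proof (cases "c < m c")
      case True
      have "m c < m b" using Homeo_plus_less_iff(1)[OF M(1) cI, of b] c abc by simp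
      then have mb: "m c < b" using M(2)[of b] abc by simp
      have "s * (m c - c) > 0" "s * (m c - c) < m c - c" using s True by simp_all
      then have "c < u c" "u c < b" using u(2)[OF cI] mb by linarith+
      then have uc: "u c \<in> {c<..<b}" "m c \<in> {c<..<b}" using mb True by simp_all
      obtain g where g: "g \<in> supported_in c b" "g (u c) = m c"
        using supported_in_transitive[OF _ abc(4) uc] cI by auto
      then show ?thesis using cb supported_in_mono[OF abc(2) order_refl] by blast
    next
      case False
      then have lt: "m c < c" using mc by simp
      have "m a < m c" using Homeo_plus_less_iff(1)[OF M(1) _ cI, of a] c abc by simp
      then have ma: "a < m c" using M(2)[of a] abc by simp
      have "s * (c - m c) > 0" "s * (c - m c) < c - m c" using s lt by simp_all
      moreover have "u c = c - s * (c - m c)" using u(2)[OF cI] by (simp add: algebra_simps)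
      ultimately have "a < u c" "u c < c" using ma by linarith+
      then have uc: "u c \<in> {a<..<c}" "m c \<in> {a<..<c}" using ma lt by simp_all
      obtain g where g: "g \<in> supported_in a c" "g (u c) = m c"
        using supported_in_transitive[OF abc(1) _ uc] cI by auto
      then show ?thesis using ac supported_in_mono[OF order_refl abc(3)] by blast
    qed
    then obtain g where g: "g \<in> supported_in a b" "act g z = z" "g (u c) = m c" by blast
    note Gc = supported_inD(1)[OF g(1)]
    let ?gu = "g \<otimes>\<^bsub>Homeo_plus\<^esub> u" and ?i = "inv\<^bsub>Homeo_plus\<^esub> m"
    have gu: "?gu \<in> supported_in a b" "?i \<in> supported_in a b"
      using supported_in_mult g(1) u(1) supported_in_inv m by blast+
    note guc = supported_inD(1)[OF gu(1)] and ic = supported_inD(1)[OF gu(2)]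
    \<comment> \<open>The inverse of \<open>m\<close> times \<open>g u\<close> fixes
      \<open>c\<close> and therefore \<open>z\<close>, so \<open>g u\<close> and \<open>m\<close>
      send \<open>z\<close> to the same point.\<close>
    have "(?i \<otimes>\<^bsub>Homeo_plus\<^esub> ?gu) c = c"
      using Homeo_plus_mult_apply[OF ic guc cI] Homeo_plus_mult_apply[OF Gc Uc cI] g(3)
        inv_Homeo_plus(2)[OF M(1) cI] by simp
    then have "act (?i \<otimes>\<^bsub>Homeo_plus\<^esub> ?gu) z = z" using fix_c supported_in_mult[OF gu(2,1)] by blast
    then have "act m z = act m (act (?i \<otimes>\<^bsub>Homeo_plus\<^esub> ?gu) z)" by simp
    also have "\<dots> = act (m \<otimes>\<^bsub>Homeo_plus\<^esub> (?i \<otimes>\<^bsub>Homeo_plus\<^esub> ?gu)) z"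
      using act_mult[OF M(1) _ z, of "?i \<otimes>\<^bsub>Homeo_plus\<^esub> ?gu"] ic guc by simp
    also have "m \<otimes>\<^bsub>Homeo_plus\<^esub> (?i \<otimes>\<^bsub>Homeo_plus\<^esub> ?gu) = ?gu"
      using M(1) ic guc by (simp add: Homeo_plus_group.m_assoc[symmetric])
    finally show False using U(3)[OF Gc uU] AB(1,2) g(2) by simp
  qed
qed

text \<open>Throughout the induction the current point stays in the closure of the
  \<open>Q\<close>-orbit of \<open>y\<close>, while the interval [0, i/N] whose homeomorphisms fix
  it grows. Maps supported between neighbouring grid points fix the grid, so they belong to
  \<open>Q\<close>.\<close>

lemma fixed_point_near:
  assumes y: "y \<in> topspace Y" and N: "N > 0"
    and Q: "Q = {q \<in> carrier Homeo_plus. \<forall>j\<le>N. q (real j / real N) = real j / real N}"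
  obtains z where "z \<in> Y closure_of ((\<lambda>q. act q y) ` Q)"
    "\<And>g. g \<in> carrier Homeo_plus \<Longrightarrow> act g z = z"
proof -
  let ?O = "(\<lambda>q. act q y) ` Q"
  let ?C = "Y closure_of ?O"
  have C: "?C \<subseteq> topspace Y" by (rule closure_of_subset_topspace)
  \<comment> \<open>\<open>Q\<close> is closed under products and acts by continuous maps.\<close>
  have inv: "act g z \<in> ?C" if g: "g \<in> Q" and z: "z \<in> ?C" for g z
  proof -
    have "act g (act q y) \<in> ?O" if q: "q \<in> Q" for q
    proof -
      have gq: "g \<in> carrier Homeo_plus" "q \<in> carrier Homeo_plus" using g q Q by auto
      have "(g \<otimes>\<^bsub>Homeo_plus\<^esub> q) (real j / real N) = real j / real N" if "j \<le> N" for j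
        using Homeo_plus_mult_apply[OF gq, of "real j / real N"] that g q Q N by simp
      then have "g \<otimes>\<^bsub>Homeo_plus\<^esub> q \<in> Q" using gq Q by simp
      moreover have "act g (act q y) = act (g \<otimes>\<^bsub>Homeo_plus\<^esub> q) y" using act_mult[OF gq y] by simp
      ultimately show ?thesis by blast
    qed
    then have "act g ` ?O \<subseteq> ?O" by blast
    moreover have "act g ` ?C \<subseteq> Y closure_of (act g ` ?O)"
      using g Q by (intro continuous_map_image_closure_subset G_space_act_continuous(1)[OF G_space_Y]) simp
    ultimately show ?thesis using z closure_of_mono by blast
  qed
  have "\<exists>z\<in>?C. \<forall>g\<in>supported_in 0 (real i / real N). act g z = z" if "i \<le> N" for i
    using that
  proof (induction i)
    case 0
    have "\<one>\<^bsub>Homeo_plus\<^esub> \<in> Q" using N by (simp add: Q one_Homeo_plus[symmetric]) (simp add: one_Homeo_plus)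
    then have "y \<in> ?O" using act_one[OF y] by (metis image_eqI)
    moreover have "?O \<subseteq> topspace Y" using act_closed[OF _ y] Q by blast
    ultimately have "y \<in> ?C" using closure_of_subset by blast
    moreover have "act g y = y" if "g \<in> supported_in 0 (real 0 / real N)" for g
      using that supported_in_trivial[of "real 0 / real N" 0] act_one[OF y] by auto
    ultimately show ?case by blast
  next
    case (Suc i)
    define a b where "a = real i / real N" and "b = real (Suc i) / real N"
    have ab: "0 \<le> a" "a < b" "b \<le> 1" using Suc.prems N by (auto simp: a_def b_def divide_strict_right_mono)
    obtain z where z: "z \<in> ?C" "\<And>g. g \<in> supported_in 0 a \<Longrightarrow> act g z = z"
      using Suc unfolding a_def by auto
    have zY: "z \<in> topspace Y" using z(1) C by blast
    obtain w where w: "w \<in> Y closure_of ((\<lambda>g. act g z) ` supported_in a b)"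
      "\<And>g. g \<in> supported_in a b \<Longrightarrow> act g w = w"
      using fixed_point_in_orbit_closure[OF zY ab] by metis
    have wY: "w \<in> topspace Y" using subsetD[OF closure_of_subset_topspace w(1)] .
    have "g \<in> Q" if g: "g \<in> supported_in a b" for g
    proof -
      have "g (real j / real N) = real j / real N" if j: "j \<le> N" for j
      proof (rule supported_inD(2)[OF g])
        show "real j / real N \<in> {0..1}" using j N by simp
        have "j \<le> i \<or> Suc i \<le> j" by linarith
        then show "real j / real N \<le> a \<or> b \<le> real j / real N"
          unfolding a_def b_def by (meson divide_right_mono of_nat_0_le_iff of_nat_mono)
      qed
      then show ?thesis using supported_inD(1)[OF g] Q by blast
    qed
    then have "(\<lambda>g. act g z) ` supported_in a b \<subseteq> ?C" using inv[OF _ z(1)] by blast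
    then have "w \<in> ?C" using w(1) closure_of_minimal closedin_closure_of by (metis subsetD)
    \<comment> \<open>Fixedness on [0, a] survives: these maps commute with those supported in
      [a, b], so they fix the whole orbit of \<open>z\<close> and, fixed point sets being closed,
      also \<open>w\<close>.\<close>
    moreover have w0: "act g w = w" if g: "g \<in> supported_in 0 a" for g
    proof -
      let ?F = "{x \<in> topspace Y. act g x = x}"
      note gc = supported_inD(1)[OF g]
      have "act h z \<in> ?F" if h: "h \<in> supported_in a b" for h
      proof -
        note hc = supported_inD(1)[OF h]
        have "act g (act h z) = act (g \<otimes>\<^bsub>Homeo_plus\<^esub> h) z" using act_mult[OF gc hc zY] by simp
        also have "g \<otimes>\<^bsub>Homeo_plus\<^esub> h = h \<otimes>\<^bsub>Homeo_plus\<^esub> g" using supported_in_commute[OF g h] ab by simp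
        also have "act (h \<otimes>\<^bsub>Homeo_plus\<^esub> g) z = act h z" using act_mult[OF hc gc zY] z(2)[OF g] by simp
        finally show ?thesis using act_closed[OF hc zY] by blast
      qed
      then have "(\<lambda>h. act h z) ` supported_in a b \<subseteq> ?F" by blast
      then have "w \<in> ?F"
        using w(1) closure_of_minimal[OF _ closedin_fixed_points[OF G_space_Y Hausdorff_Y gc]] by blast
      then show ?thesis by simp
    qed
    moreover have "act g w = w" if "g \<in> supported_in 0 b" for g
      by (rule fixed_by_adjacent_intervals[OF wY order_refl ab(1) less_imp_le[OF ab(2)] ab(3) w0 w(2) that])
    ultimately show ?case unfolding b_def by blast
  qed
  from this[of N] obtain z where z: "z \<in> ?C" "\<forall>g\<in>supported_in 0 (real N / real N). act g z = z" by blast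
  have "supported_in 0 (real N / real N) = carrier Homeo_plus" using N supported_in_0_1 by simp
  then show ?thesis using that z by simp
qed

text \<open>If \<open>k\<close> moved \<open>y\<close>, a neighbourhood \<open>W\<close> of
  \<open>y\<close> would lie in \<open>B\<close> and be sent into \<open>A\<close> by
  \<open>k\<close>. For large \<open>N\<close> the \<open>Q\<close>-orbit of \<open>y\<close> stays
  in \<open>W\<close>, so the global fixed point in its closure would lie in both of the disjoint
  closures.\<close>

theorem act_trivial:
  assumes k: "k \<in> carrier Homeo_plus" and y: "y \<in> topspace Y"
  shows "act k y = y"
proof (rule ccontr)
  assume neq: "act k y \<noteq> y"
  obtain A B where AB: "openin Y A" "openin Y B" "act k y \<in> A" "y \<in> B"
    "Y closure_of A \<inter> Y closure_of B = {}"
    using regular_separation[OF compact_Hausdorff_imp_regular_space[OF compact_Y Hausdorff_Y]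
        Hausdorff_Y act_closed[OF k y] y neq] by metis
  define W where "W = B \<inter> {x \<in> topspace Y. act k x \<in> A}"
  note ck = G_space_act_continuous(1)[OF G_space_Y k]
  have W: "openin Y W" "y \<in> W"
    unfolding W_def using openin_continuous_map_preimage[OF ck AB(1)] AB(2-4) y by auto
  define V where "V = {g \<in> topspace Homeo_plus_topology. act g y \<in> W}"
  have V: "openin Homeo_plus_topology V"
    unfolding V_def
    using openin_continuous_map_preimage[OF G_space_act_continuous(2)[OF G_space_Y y] W(1)] .
  have one: "\<one>\<^bsub>Homeo_plus\<^esub> \<in> V"
    using topological_group_Homeo_plus act_one[OF y] W(2) by (simp add: V_def topological_group_def)
  obtain r where r: "r > 0" "\<And>g. g \<in> carrier Homeo_plus \<Longrightarrow> Homeo_plus_dist \<one>\<^bsub>Homeo_plus\<^esub> g < r \<Longrightarrow> g \<in> V"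
    using Homeo_plus_open_ball[OF V one] by metis
  obtain n where n: "1 / real (Suc n) < r" using r(1) by (rule nat_approx_posE)
  define N where "N = Suc n"
  have N: "N > 0" "1 / real N < r" using n by (simp_all add: N_def)
  define Q where "Q = {q \<in> carrier Homeo_plus. \<forall>j\<le>N. q (real j / real N) = real j / real N}"
  \<comment> \<open>Fixing the grid points, \<open>q\<close> preserves every grid cell, so it moves
    no point by more than the mesh.\<close>
  have "q \<in> V" if q: "q \<in> Q" for q
  proof -
    have qc: "q \<in> carrier Homeo_plus" using q by (simp add: Q_def)
    have "\<bar>\<one>\<^bsub>Homeo_plus\<^esub> x - q x\<bar> \<le> 1 / real N" if x: "x \<in> {0..1}" for x
    proof -
      \<comment> \<open>The left end of the grid cell of \<open>x\<close> is j / N. The value j = N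
        occurs for x = 1 only and is treated apart, as no cell starts there.\<close>
      define j where "j = nat \<lfloor>x * real N\<rfloor>"
      have j: "real j \<le> x * real N" "x * real N < real j + 1" using x by (auto simp: j_def)
      then have j': "real j / real N \<le> x" "x < real (Suc j) / real N" using N(1) by (auto simp: field_simps)
      have "x * real N \<le> real N" using x by (simp add: mult_left_le_one_le)
      then have "j \<le> N" using j by linarith
      have "\<bar>x - q x\<bar> \<le> 1 / real N"
      proof (cases "j = N")
        case True
        then have "x = 1" using j'(1) x N(1) by simp
        then show ?thesis using Homeo_plus_endpoints(2)[OF qc] by simp
      next
        case False
        then have I: "real j / real N \<in> {0..1}" "real (Suc j) / real N \<in> {0..1}" "Suc j \<le> N"
          using \<open>j \<le> N\<close> N(1) by auto
        have "q (real j / real N) \<le> q x" "q x \<le> q (real (Suc j) / real N)"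
          using Homeo_plus_less_iff(2)[OF qc] I x j' by simp_all
        moreover have "q (real j / real N) = real j / real N" "q (real (Suc j) / real N) = real (Suc j) / real N"
          using q I(3) \<open>j \<le> N\<close> unfolding Q_def by blast+
        ultimately have "real j / real N \<le> q x" "q x \<le> real (Suc j) / real N" by simp_all
        moreover have "real (Suc j) / real N = real j / real N + 1 / real N" by (simp add: add_divide_distrib)
        ultimately show ?thesis using j' by linarith
      qed
      then show ?thesis using x by (simp add: one_Homeo_plus)
    qed
    then have "Homeo_plus_dist \<one>\<^bsub>Homeo_plus\<^esub> q \<le> 1 / real N"
      using Homeo_plus_dist_le[OF Homeo_plus_group.one_closed qc] by blast
    then show ?thesis using r(2)[OF qc] N(2) by simp
  qed
  then have QW: "(\<lambda>q. act q y) ` Q \<subseteq> W" by (auto simp: V_def)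
  obtain z where z: "z \<in> Y closure_of ((\<lambda>q. act q y) ` Q)" "\<And>g. g \<in> carrier Homeo_plus \<Longrightarrow> act g z = z"
    using fixed_point_near[OF y N(1) Q_def] by metis
  have zW: "z \<in> Y closure_of W" using z(1) closure_of_mono[OF QW] by blast
  then have "z \<in> Y closure_of B" using closure_of_mono[of W B] by (auto simp: W_def)
  moreover have "act k z \<in> Y closure_of (act k ` W)"
    using continuous_map_image_closure_subset[OF ck] zW by blast
  then have "act k z \<in> Y closure_of A" using closure_of_mono[of "act k ` W" A] by (auto simp: W_def)
  ultimately show False using z(2)[OF k] AB(5) by auto
qed

end

section \<open>From trivial actions to constant functions\<close>

lemma SUC_functions_Homeo_plus_constant:
  assumes "f \<in> SUC_functions TYPE('y) Homeo_plus Homeo_plus_topology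
    Homeo_plus_topology (\<lambda>g x. g \<otimes>\<^bsub>Homeo_plus\<^esub> x)"
  shows "f constant_on carrier Homeo_plus"
proof -
  obtain Y :: "'y topology" and act \<nu> F where *:
    "G_compactification Homeo_plus Homeo_plus_topology Homeo_plus_topology (\<lambda>g x. g \<otimes>\<^bsub>Homeo_plus\<^esub> x) Y act \<nu>"
    "SUC_G_space Homeo_plus Homeo_plus_topology Y act"
    "\<forall>x\<in>topspace Homeo_plus_topology. f x = F (\<nu> x)"
    using assms unfolding SUC_functions_def by blast
  interpret Homeo_plus_SUC_space Y act by standard (rule *(2))
  have top: "topspace Homeo_plus_topology = carrier Homeo_plus"
    using topological_group_Homeo_plus by (simp add: topological_group_def)
  have \<nu>: "continuous_map Homeo_plus_topology Y \<nu>"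
    "\<forall>g\<in>carrier Homeo_plus. \<forall>x\<in>carrier Homeo_plus. \<nu> (g \<otimes>\<^bsub>Homeo_plus\<^esub> x) = act g (\<nu> x)"
    using *(1) top unfolding G_compactification_def G_map_def by auto
  have Y: "\<nu> \<one>\<^bsub>Homeo_plus\<^esub> \<in> topspace Y"
    using continuous_map_image_subset_topspace[OF \<nu>(1)] top by auto
  have "f g = F (\<nu> \<one>\<^bsub>Homeo_plus\<^esub>)" if g: "g \<in> carrier Homeo_plus" for g
  proof -
    \<comment> \<open>Equivariance at the neutral element shows that the image of the group is a
      single orbit, which is a point.\<close>
    have "\<nu> g = act g (\<nu> \<one>\<^bsub>Homeo_plus\<^esub>)"
      using \<nu>(2)[rule_format, OF g Homeo_plus_group.one_closed] g by simp
    then show ?thesis using *(3) g top act_trivial[OF g Y] by simp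
  qed
  then show ?thesis unfolding constant_on_def by blast
qed

text \<open>A one-point space with the trivial action does: entourages contain the diagonal, so the
  whole group serves as the neighbourhood, and the image is dense because \<open>X\<close> is
  nonempty.\<close>

lemma constant_in_SUC_functions:
  assumes G: "G_space G T X actX" and X: "topspace X \<noteq> {}" and f: "f constant_on topspace X"
  shows "f \<in> SUC_functions TYPE('y) G T X actX"
proof -
  obtain c where c: "\<And>x. x \<in> topspace X \<Longrightarrow> f x = c" using f unfolding constant_on_def by blast
  \<comment> \<open>\<open>undefined\<close> supplies a point of the arbitrary type
    \<open>'y\<close>.\<close>
  define p :: 'y where "p = undefined"
  let ?Y = "discrete_topology {p}"
  have "Tychonoff_space ?Y"
    unfolding Tychonoff_space_def by (simp add: completely_regular_space_discrete_topology)
  moreover have "continuous_map (prod_topology T ?Y) ?Y (\<lambda>(g, x). x)"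
    using continuous_map_snd[of T ?Y] by (simp add: case_prod_unfold)
  ultimately have GY: "G_space G T ?Y (\<lambda>g x. x)"
    using G unfolding G_space_def by simp
  have cY: "compact_space ?Y" "Hausdorff_space ?Y" by (simp_all add: compact_space_discrete_topology)
  have "SUC_G_space G T ?Y (\<lambda>g x. x)"
    unfolding SUC_G_space_def
  proof (intro conjI ballI GY cY)
    fix x \<epsilon> assume "x \<in> topspace ?Y" "\<epsilon> \<in> the_uniformity ?Y"
    then have "(x, x) \<in> \<epsilon>" unfolding the_uniformity_eq[OF cY] diag_nbhds_def by auto
    moreover have "topological_group G T" using G by (simp add: G_space_def)
    then have "openin T (carrier G)" "\<one>\<^bsub>G\<^esub> \<in> carrier G"
      unfolding topological_group_def by (metis openin_topspace, metis group.is_monoid monoid.one_closed)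
    ultimately show "\<exists>U. openin T U \<and> \<one>\<^bsub>G\<^esub> \<in> U \<and> (\<forall>g\<in>carrier G. \<forall>u\<in>U. (x, x) \<in> \<epsilon>)" by blast
  qed
  moreover have "G_compactification G T X actX ?Y (\<lambda>g x. x) (\<lambda>_. p)"
    unfolding G_compactification_def G_map_def
    using G GY cY X closure_of_topspace[of ?Y] by (simp add: image_constant_conv)
  moreover have "continuous_map X euclideanreal f"
    by (rule continuous_map_eq[of _ _ "\<lambda>_. c"]) (use c in auto)
  moreover have "bounded (f ` topspace X)"
    by (rule bounded_subset[of "{c}"]) (use c in auto)
  moreover have "continuous_map ?Y euclideanreal (\<lambda>_. c)" by simp
  ultimately show ?thesis unfolding SUC_functions_def using c by blast
qed

text \<open>As the equality holds for every type \<open>'y\<close>, it passes to the union over all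
  types that represents SUC(G). Constancy is asked on the carrier only, because values elsewhere
  carry no meaning.\<close>

theorem theorem8p3:
  shows "SUC_functions TYPE('y) Homeo_plus Homeo_plus_topology
           Homeo_plus_topology (\<lambda>g x. g \<otimes>\<^bsub>Homeo_plus\<^esub> x)
         = {f. f constant_on carrier Homeo_plus}"
proof -
  have top: "topspace Homeo_plus_topology = carrier Homeo_plus"
    using topological_group_Homeo_plus by (simp add: topological_group_def)
  then have "topspace Homeo_plus_topology \<noteq> {}" using Homeo_plus_group.one_closed by blast
  from constant_in_SUC_functions[OF G_space_Homeo_plus_left this] show ?thesis
    using SUC_functions_Homeo_plus_constant unfolding top by blast
qed

end
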